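(* Let $\mathbb{K}$ be an algebraically closed field of characteristic zero and let $N=2m\geq 2$ be even. Then $$\operatorname{Aut}(\mathcal{H}_{N})\cong \operatorname{Aut}(\mathcal{H}_{N}')\cong \mathbf{GSp}_{N}(\mathbb{Z})\ltimes (\mathbb{K}^{\times})^{N}.$$
   Context: Let $A_N=\mathbb{K}[t_1^{\pm1},\dots,t_N^{\pm1}]$, $d_i=t_i\frac{\partial}{\partial t_i}$, and for $\bm{r}=(r_1,\dots,r_N)^\top\in\mathbb{Z}^N$ write $t^{\bm r}=t_1^{r_1}\cdots t_N^{r_N}$. Let $(\cdot,\cdot)$ be the bilinear form on $\mathbb{K}^N$ with $(e_i,e_j)=\delta_{ij}$ ($e_i$ the standard basis vectors), and $\mathbb{Z}^N\subset\mathbb{K}^N$. For $u\in\mathbb{K}^N$, $\bm r\in\mathbb{Z}^N$ put $D(u,\bm r)=\sum_{i=1}^N u_i t^{\bm r}d_i$, a derivation of $A_N$. Let $\bm J=\begin{pmatrix} O_m & I_m\\ -I_m & O_m\end{pmatrix}$ and $\overline{\bm r}=\bm J\bm r$. Put $h_{\bm r}=D(\overline{\bm r},\bm r)$ (so $h_{\bm 0}=0$) and $\mathfrak h=\operatorname{span}_{\mathbb{K}}\{d_1,\dots,d_N\}=\{D(u,\bm 0):u\in\mathbb{K}^N\}$. The Hamiltonian Lie algebra is $\mathcal{H}_N=\operatorname{span}_{\mathbb{K}}\{h_{\bm r}:\bm r\in\mathbb{Z}^N\setminus\{\bm 0\}\}\oplus\mathfrak h$, a Lie subalgebra of the Lie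 algebra of derivations of $A_N$ under the commutator bracket; in particular $[h_{\bm r},h_{\bm s}]=(\overline{\bm r},\bm s)h_{\bm r+\bm s}$ and $[D(u,\bm 0),h_{\bm r}]=(u,\bm r)h_{\bm r}$. Its derived subalgebra is $\mathcal{H}_N'=[\mathcal{H}_N,\mathcal{H}_N]=\operatorname{span}_{\mathbb{K}}\{h_{\bm r}:\bm r\neq\bm 0\}$. The conformal symplectic group is $\mathbf{GSp}_N(\mathbb{Z})=\{\bm Q\in\mathbf{GL}_N(\mathbb{Z}):\bm Q^\top\bm J\bm Q=\pm\bm J\}$. The symbol $\ltimes$ denotes a semidirect product in which $(\mathbb{K}^\times)^N$ is the normal subgroup. *)

theory Defs
  imports "HOL-Algebra.Bij" "HOL-Computational_Algebra.Polynomial"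
begin

definition alg_closed :: "'k::field itself \<Rightarrow> bool" where
  "alg_closed _ = (\<forall>p::'k poly. degree p \<ge> 1 \<longrightarrow> (\<exists>x. poly p x = 0))"

definition zvecs :: "nat \<Rightarrow> (nat \<Rightarrow> int) set" where
  "zvecs N = {r. \<forall>i\<ge>N. r i = 0}"

(* r-bar = J r with J = [[0, I_m], [-I_m, 0]] *)
definition Jbar :: "nat \<Rightarrow> (nat \<Rightarrow> int) \<Rightarrow> (nat \<Rightarrow> int)" where
  "Jbar m r = (\<lambda>i. if i < m then r (i + m) else if i < 2*m then - r (i - m) else 0)"

definition pairing :: "nat \<Rightarrow> (nat \<Rightarrow> 'k::field) \<Rightarrow> (nat \<Rightarrow> int) \<Rightarrow> 'k" where
  "pairing N u r = (\<Sum>i<N. u i * of_int (r i))"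

definition ipairing :: "nat \<Rightarrow> (nat \<Rightarrow> int) \<Rightarrow> (nat \<Rightarrow> int) \<Rightarrow> int" where
  "ipairing N r s = (\<Sum>i<N. r i * s i)"

(* Elements of H_N: (c, u) stands for  sum_{r<>0} c(r) h_r + D(u,0). *)
type_synonym 'k ham = "((nat \<Rightarrow> int) \<Rightarrow> 'k) \<times> (nat \<Rightarrow> 'k)"

definition ham_carrier :: "nat \<Rightarrow> 'k::field ham set" where
  "ham_carrier N = {(c, u). finite {r. c r \<noteq> 0} \<and>
      (\<forall>r. c r \<noteq> 0 \<longrightarrow> r \<in> zvecs N \<and> r \<noteq> (\<lambda>_. 0)) \<and> (\<forall>i\<ge>N. u i = 0)}"

definition ham_derived_carrier :: "nat \<Rightarrow> 'k::field ham set" where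
  "ham_derived_carrier N = {x \<in> ham_carrier N. snd x = (\<lambda>_. 0)}"

definition ham_add :: "'k::field ham \<Rightarrow> 'k ham \<Rightarrow> 'k ham" where
  "ham_add x y = ((\<lambda>r. fst x r + fst y r), (\<lambda>i. snd x i + snd y i))"

definition ham_scale :: "'k::field \<Rightarrow> 'k ham \<Rightarrow> 'k ham" where
  "ham_scale a x = ((\<lambda>r. a * fst x r), (\<lambda>i. a * snd x i))"

(* bilinear extension of [h_r,h_s] = (rbar,s) h_{r+s}, [D(u,0),h_r] = (u,r) h_r,
   [D(u,0),D(v,0)] = 0, with h_0 = 0 *)
definition ham_bracket :: "nat \<Rightarrow> 'k::field ham \<Rightarrow> 'k ham \<Rightarrow> 'k ham" where
  "ham_bracket m x y =
     (case x of (c1, u1) \<Rightarrow> case y of (c2, u2) \<Rightarrow>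
       ((\<lambda>t. if t = (\<lambda>_. 0) then 0 else
            (\<Sum>r\<in>{r. c1 r \<noteq> 0}. c1 r * c2 (\<lambda>i. t i - r i) * of_int (ipairing (2*m) (Jbar m r) (\<lambda>i. t i - r i)))
            + pairing (2*m) u1 t * c2 t - pairing (2*m) u2 t * c1 t),
        (\<lambda>_. 0)))"

definition lie_aut_group ::
  "'a set \<Rightarrow> ('a \<Rightarrow> 'a \<Rightarrow> 'a) \<Rightarrow> ('k \<Rightarrow> 'a \<Rightarrow> 'a) \<Rightarrow> ('a \<Rightarrow> 'a \<Rightarrow> 'a) \<Rightarrow> ('a \<Rightarrow> 'a) monoid" where
  "lie_aut_group V add sc br = (BijGroup V)\<lparr>carrier :=
     {f \<in> Bij V. (\<forall>x\<in>V. \<forall>y\<in>V. f (add x y) = add (f x) (f y)) \<and>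
                (\<forall>a. \<forall>x\<in>V. f (sc a x) = sc a (f x)) \<and>
                (\<forall>x\<in>V. \<forall>y\<in>V. f (br x y) = br (f x) (f y))}\<rparr>"

definition Aut_H :: "nat \<Rightarrow> 'k::field itself \<Rightarrow> ('k ham \<Rightarrow> 'k ham) monoid" where
  "Aut_H m _ = lie_aut_group (ham_carrier (2*m)) ham_add ham_scale (ham_bracket m)"

definition Aut_H' :: "nat \<Rightarrow> 'k::field itself \<Rightarrow> ('k ham \<Rightarrow> 'k ham) monoid" where
  "Aut_H' m _ = lie_aut_group (ham_derived_carrier (2*m)) ham_add ham_scale (ham_bracket m)"

definition intmats :: "nat \<Rightarrow> (nat \<Rightarrow> nat \<Rightarrow> int) set" where
  "intmats N = {A. \<forall>i j. (i \<ge> N \<or> j \<ge> N) \<longrightarrow> A i j = 0}"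

definition mat_mul :: "nat \<Rightarrow> (nat \<Rightarrow> nat \<Rightarrow> int) \<Rightarrow> (nat \<Rightarrow> nat \<Rightarrow> int) \<Rightarrow> (nat \<Rightarrow> nat \<Rightarrow> int)" where
  "mat_mul N A B = (\<lambda>i j. \<Sum>k<N. A i k * B k j)"

definition mat_id :: "nat \<Rightarrow> (nat \<Rightarrow> nat \<Rightarrow> int)" where
  "mat_id N = (\<lambda>i j. if i = j \<and> i < N then 1 else 0)"

definition mat_T :: "(nat \<Rightarrow> nat \<Rightarrow> int) \<Rightarrow> (nat \<Rightarrow> nat \<Rightarrow> int)" where
  "mat_T A = (\<lambda>i j. A j i)"

definition Jmat :: "nat \<Rightarrow> (nat \<Rightarrow> nat \<Rightarrow> int)" where
  "Jmat m = (\<lambda>i j. if i < m \<and> j = i + m then 1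
                    else if m \<le> i \<and> i < 2*m \<and> j = i - m then -1 else 0)"

definition GL_Z :: "nat \<Rightarrow> (nat \<Rightarrow> nat \<Rightarrow> int) set" where
  "GL_Z N = {Q \<in> intmats N. \<exists>Q'\<in>intmats N. mat_mul N Q Q' = mat_id N \<and> mat_mul N Q' Q = mat_id N}"

definition GSp_Z :: "nat \<Rightarrow> (nat \<Rightarrow> nat \<Rightarrow> int) set" where
  "GSp_Z m = {Q \<in> GL_Z (2*m).
      mat_mul (2*m) (mat_mul (2*m) (mat_T Q) (Jmat m)) Q = Jmat m \<or>
      mat_mul (2*m) (mat_mul (2*m) (mat_T Q) (Jmat m)) Q = (\<lambda>i j. - Jmat m i j)}"

definition torus :: "nat \<Rightarrow> (nat \<Rightarrow> 'k::field) set" where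
  "torus N = {a. (\<forall>i<N. a i \<noteq> 0) \<and> (\<forall>i\<ge>N. a i = 1)}"

(* action of Q on the torus: (Q . a)_j = prod_i a_i^(Q_ji), i.e. (Q . a)^r = a^(Q^T r) *)
definition torus_act :: "nat \<Rightarrow> (nat \<Rightarrow> nat \<Rightarrow> int) \<Rightarrow> (nat \<Rightarrow> 'k::field) \<Rightarrow> (nat \<Rightarrow> 'k)" where
  "torus_act N Q a = (\<lambda>j. if j < N then (\<Prod>i<N. a i powi Q j i) else 1)"

definition GSp_ltimes_torus :: "nat \<Rightarrow> 'k::field itself \<Rightarrow> ((nat \<Rightarrow> nat \<Rightarrow> int) \<times> (nat \<Rightarrow> 'k)) monoid" where
  "GSp_ltimes_torus m _ = \<lparr>carrier = GSp_Z m \<times> torus (2*m),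
     monoid.mult = (\<lambda>(Q1, a1) (Q2, a2). (mat_mul (2*m) Q1 Q2, \<lambda>j. a1 j * torus_act (2*m) Q1 a2 j)),
     monoid.one = (mat_id (2*m), \<lambda>_. 1)\<rparr>"

end

theory Submission
  imports Defs "HOL-Library.Function_Algebras"
begin

text \<open>Let \<open>f\<close> be an automorphism of \<open>H'\<close>. Conjugating the torus derivations \<open>d\<^sub>i\<close> by \<open>f\<close> gives
  locally finite derivations of \<open>H'\<close>. Split such a derivation into homogeneous components for
  the grading by \<open>\<int>\<^sup>N\<close>: the Leibniz rule forces a component of degree \<open>t \<noteq> 0\<close> to be a multiple of
  \<open>ad h\<^sub>t\<close> wherever \<open>(t, s) \<noteq> 0\<close> for the symplectic form, so there are only finitely many
  components, and an extremal one contradicts local finiteness. Hence the conjugates of the \<open>d\<^sub>i\<close>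
  are diagonal and \<open>f\<close> permutes the lines spanned by the \<open>h\<^sub>r\<close>. The permutation is additive and
  preserves the symplectic form up to a sign, and the scalars are that sign times a character of
  \<open>\<int>\<^sup>N\<close>. An automorphism of \<open>H\<close> preserves \<open>H'\<close> because \<open>[D(u, 0), h\<^sub>r] = (u, r) h\<^sub>r\<close>, and it is
  determined by its restriction because \<open>H'\<close> has trivial centralizer in \<open>H\<close>.\<close>

section \<open>The symplectic form on integer vectors\<close>

text \<open>Vectors and elements of the algebra are functions of higher type. Evaluating their sums
  pointwise by default would destroy the vector structure of eta-expanded terms.\<close>

declare zero_fun_apply [simp del] plus_fun_apply [simp del] minus_apply [simp del]
  uminus_apply [simp del]

lemmas fun_apply = zero_fun_apply plus_fun_apply minus_apply uminus_apply

text \<open>The obstacle throughout is that \<open>[h_r, h_s]\<close> vanishes for orthogonal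
  \<open>r\<close> and \<open>s\<close>, so brackets give relations only for pairs with nonzero
  form. The gap is closed by auxiliary lattice vectors in three places: for the components of a
  derivation, for additivity of the index permutation, and for multiplicativity of the scalars. The
  last two share one lemma about an abstract operation \<open>op\<close>. The sign arises because
  the permutation scales the form by an integer \<open>e\<close> that must divide 1. The scalars
  then satisfy \<open>b (r + s) = e b r b s\<close>, so that \<open>e b\<close>, rather than
  \<open>b\<close>, is a character. The matrix of an automorphism is read off from its inverse: the
  image has at \<open>t\<close> a multiple of the old coefficient at \<open>Q^T t\<close>. With this
  choice composition becomes the matrix product in the given order, and the torus is twisted exactly
  by \<open>torus_act\<close>. One formula makes the semidirect product act on both \<open>H\<close>
  and \<open>H'\<close>, and the two automorphism groups are compared through it.\<close>

definition omega :: "nat \<Rightarrow> (nat \<Rightarrow> int) \<Rightarrow> (nat \<Rightarrow> int) \<Rightarrow> int" where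
  "omega m r s = ipairing (2*m) (Jbar m r) s"

definition unit_vec :: "nat \<Rightarrow> nat \<Rightarrow> int" where
  "unit_vec i = (\<lambda>j. if j = i then 1 else 0)"

abbreviation nzvecs :: "nat \<Rightarrow> (nat \<Rightarrow> int) set" where
  "nzvecs N \<equiv> zvecs N - {0}"

lemma sum_fun_apply: "(\<Sum>i\<in>A. f i) x = (\<Sum>i\<in>A. f i x)"
  by (induction A rule: infinite_finite_induct) (auto simp: fun_apply)

text \<open>Folding the index \<open>i + m\<close> onto \<open>i\<close> turns the pairing with
  \<open>J r\<close> into a sum of \<open>m\<close> determinants of size two. Bilinearity and skew
  symmetry are all read off from this form.\<close>

lemma omega_alt: "omega m r s = (\<Sum>i<m. r (i + m) * s i - r i * s (i + m))"
proof -
  have split: "{..<2*m} = {..<m} \<union> (\<lambda>i. i + m) ` {..<m}"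
  proof (intro equalityI subsetI)
    fix x assume "x \<in> {..<2*m}"
    then show "x \<in> {..<m} \<union> (\<lambda>i. i + m) ` {..<m}"
      by (cases "x < m") (auto intro!: image_eqI[of _ _ "x - m"])
  qed auto
  have "omega m r s = (\<Sum>i<m. Jbar m r i * s i) + (\<Sum>i\<in>(\<lambda>i. i + m) ` {..<m}. Jbar m r i * s i)"
    unfolding omega_def ipairing_def split by (rule sum.union_disjoint) auto
  also have "(\<Sum>i\<in>(\<lambda>i. i + m) ` {..<m}. Jbar m r i * s i) = (\<Sum>i<m. Jbar m r (i + m) * s (i + m))"
    by (subst sum.reindex) (auto simp: inj_on_def)
  finally show ?thesis
    by (simp add: Jbar_def sum_subtractf sum_negf)
qed

lemma omega_add_left: "omega m (r + r') s = omega m r s + omega m r' s"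
  by (simp add: omega_alt fun_apply algebra_simps sum.distrib sum_subtractf)

lemma omega_add_right: "omega m r (s + s') = omega m r s + omega m r s'"
  by (simp add: omega_alt fun_apply algebra_simps sum.distrib sum_subtractf)

lemma omega_minus_left: "omega m (- r) s = - omega m r s"
  by (simp add: omega_alt fun_apply sum_negf[symmetric])

lemma omega_minus_right: "omega m r (- s) = - omega m r s"
  by (simp add: omega_alt fun_apply sum_negf[symmetric])

lemma omega_diff_left: "omega m (r - r') s = omega m r s - omega m r' s"
  by (simp add: omega_alt fun_apply algebra_simps sum.distrib sum_subtractf)

lemma omega_diff_right: "omega m r (s - s') = omega m r s - omega m r s'"
  by (simp add: omega_alt fun_apply algebra_simps sum.distrib sum_subtractf)

lemma omega_skew: "omega m r s = - omega m s r"
  by (simp add: omega_alt fun_apply sum_negf[symmetric] algebra_simps)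

lemma omega_self [simp]: "omega m r r = 0"
  using omega_skew[of m r r] by simp

lemma omega_zero_left [simp]: "omega m 0 s = 0"
  by (simp add: omega_alt fun_apply)

lemma omega_zero_right [simp]: "omega m s 0 = 0"
  by (simp add: omega_alt fun_apply)

lemma omega_scale_right: "omega m s (\<lambda>i. k * r i) = k * omega m s r"
  by (simp add: omega_alt fun_apply sum_distrib_left algebra_simps)

lemmas omega_bilinear = omega_add_left omega_add_right omega_minus_left omega_minus_right
  omega_diff_left omega_diff_right

lemma omega_unit_right:
  "i < m \<Longrightarrow> omega m r (unit_vec i) = r (i + m)"
  "i < m \<Longrightarrow> omega m r (unit_vec (i + m)) = - r i"
proof -
  assume i: "i < m"
  have "omega m r (unit_vec i) = (\<Sum>j<m. if j = i then r (i + m) else 0)"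
    unfolding omega_alt unit_vec_def using i by (intro sum.cong) auto
  then show "omega m r (unit_vec i) = r (i + m)" using i by simp
  have "omega m r (unit_vec (i + m)) = (\<Sum>j<m. if j = i then - r i else 0)"
    unfolding omega_alt unit_vec_def using i by (intro sum.cong) auto
  then show "omega m r (unit_vec (i + m)) = - r i" using i by simp
qed

lemma zvecs_zero [simp]: "0 \<in> zvecs N" by (simp add: zvecs_def fun_apply)

lemma zvecs_add: "r \<in> zvecs N \<Longrightarrow> s \<in> zvecs N \<Longrightarrow> r + s \<in> zvecs N"
  by (simp add: zvecs_def fun_apply)

lemma zvecs_diff: "r \<in> zvecs N \<Longrightarrow> s \<in> zvecs N \<Longrightarrow> r - s \<in> zvecs N"
  by (simp add: zvecs_def fun_apply)

lemma zvecs_minus: "r \<in> zvecs N \<Longrightarrow> - r \<in> zvecs N"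
  by (simp add: zvecs_def fun_apply)

lemma zvecs_scale: "r \<in> zvecs N \<Longrightarrow> (\<lambda>i. k * r i) \<in> zvecs N"
  by (simp add: zvecs_def fun_apply)

lemma unit_vec_zvecs: "i < N \<Longrightarrow> unit_vec i \<in> zvecs N"
  by (simp add: zvecs_def unit_vec_def)

lemma unit_vec_nonzero: "unit_vec i \<noteq> 0"
  by (auto simp add: unit_vec_def fun_eq_iff fun_apply)

lemma zvecs_nonzero_coord:
  assumes "r \<in> nzvecs N"
  obtains i where "i < N" "r i \<noteq> 0"
  using assms by (auto simp: zvecs_def fun_eq_iff fun_apply) (metis not_less)

lemma zvecs_expand:
  assumes "r \<in> zvecs N"
  shows "r = (\<Sum>i<N. (\<lambda>j. r i * unit_vec i j))"
proof
  fix j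
  have "(\<Sum>i<N. (\<lambda>j. r i * unit_vec i j)) j = (\<Sum>i<N. if i = j then r j else 0)"
    unfolding sum_fun_apply by (intro sum.cong) (auto simp: unit_vec_def)
  then show "r j = (\<Sum>i<N. (\<lambda>j. r i * unit_vec i j)) j"
    using assms by (auto simp: zvecs_def)
qed

text \<open>A nonzero coordinate of \<open>r\<close> is read off by the unit vector in the opposite
  half. That the witness is a unit vector matters: finitely many test vectors detect every nonzero
  \<open>r\<close>, which later bounds the set of degrees of a derivation.\<close>

lemma omega_nondegenerate:
  assumes "r \<in> nzvecs (2*m)"
  obtains j where "j < 2*m" "omega m r (unit_vec j) \<noteq> 0"
proof -
  obtain i where i: "i < 2*m" "r i \<noteq> 0" using assms by (rule zvecs_nonzero_coord)
  show ?thesis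
  proof (cases "i < m")
    case True
    with i that[of "i + m"] show ?thesis by (auto simp: omega_unit_right)
  next
    case False
    with i that[of "i - m"] omega_unit_right(1)[of "i - m" m r] show ?thesis by auto
  qed
qed

text \<open>The lattice is not covered by finitely many hyperplanes. By induction, a vector good for
  \<open>F\<close> is stretched and then corrected by a unit vector that detects the new
  \<open>v\<close>.\<close>

lemma omega_avoid:
  assumes "finite F" "F \<subseteq> nzvecs (2*m)"
  obtains z where "z \<in> zvecs (2*m)" "\<And>v. v \<in> F \<Longrightarrow> omega m v z \<noteq> 0"
proof -
  have "\<exists>z\<in>zvecs (2*m). \<forall>v\<in>F. omega m v z \<noteq> 0"
    using assms
  proof (induction F rule: finite_induct)
    case empty
    then show ?case by (auto intro: zvecs_zero)
  next
    case (insert v F)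
    then obtain z where z: "z \<in> zvecs (2*m)" "\<forall>v\<in>F. omega m v z \<noteq> 0" by auto
    show ?case
    proof (cases "omega m v z = 0")
      case False
      with z show ?thesis by auto
    next
      case True
      obtain j where j: "j < 2*m" "omega m v (unit_vec j) \<noteq> 0"
        using insert.prems omega_nondegenerate[of v m] by auto
      define w where "w = unit_vec j"
      \<comment> \<open>The factor exceeds every \<open>\<bar>omega m v w\<bar>\<close> with
        \<open>v\<close> in \<open>F\<close>, so the correction \<open>w\<close> cannot cancel a
        nonzero integer multiple of \<open>k\<close>.\<close>
      define k where "k = 1 + (\<Sum>v\<in>F. \<bar>omega m v w\<bar>)"
      have z': "(\<lambda>i. k * z i) + w \<in> zvecs (2*m)"
        using z j by (auto simp: w_def intro!: zvecs_add zvecs_scale unit_vec_zvecs)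
      have "omega m v' ((\<lambda>i. k * z i) + w) \<noteq> 0" if "v' \<in> F" for v'
      proof
        assume "omega m v' ((\<lambda>i. k * z i) + w) = 0"
        then have "k * omega m v' z = - omega m v' w"
          by (simp add: omega_add_right omega_scale_right)
        then have "\<bar>k\<bar> * \<bar>omega m v' z\<bar> = \<bar>omega m v' w\<bar>" by (metis abs_minus_cancel abs_mult)
        moreover have "\<bar>omega m v' w\<bar> \<le> (\<Sum>v\<in>F. \<bar>omega m v w\<bar>)"
          by (rule member_le_sum[OF that]) (use insert.hyps in auto)
        then have "\<bar>omega m v' w\<bar> < \<bar>k\<bar>" by (simp add: k_def)
        moreover have "\<bar>omega m v' z\<bar> \<ge> 1" using z that by (simp add: int_one_le_iff_zero_less)
        then have "\<bar>k\<bar> \<le> \<bar>k\<bar> * \<bar>omega m v' z\<bar>" using mult_left_mono[of 1 _ "\<bar>k\<bar>"] by fastforce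
        ultimately show False by linarith
      qed
      moreover have "omega m v ((\<lambda>i. k * z i) + w) \<noteq> 0"
        using j True by (simp add: omega_add_right omega_scale_right w_def)
      ultimately show ?thesis using z' by auto
    qed
  qed
  then show ?thesis using that by blast
qed

text \<open>Associativity of \<open>(r + s) + z\<close> reduces the degenerate pairs \<open>(r, s)\<close> to non-degenerate ones,
  for a \<open>z\<close> in general position.\<close>

lemma quasi_additive_imp_additive:
  assumes zero: "\<And>x. op (F 0) x = x" "\<And>x. op x (F 0) = x"
    and assoc: "\<And>x y z. op (op x y) z = op x (op y z)"
    and cancel: "\<And>x y z. z \<in> zvecs (2*m) \<Longrightarrow> op x (F z) = op y (F z) \<Longrightarrow> x = y"
    and quasi: "\<And>r s. r \<in> zvecs (2*m) \<Longrightarrow> s \<in> zvecs (2*m) \<Longrightarrow> omega m r s \<noteq> 0 \<Longrightarrow>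
        F (r + s) = op (F r) (F s)"
    and rs: "r \<in> zvecs (2*m)" "s \<in> zvecs (2*m)"
  shows "F (r + s) = op (F r) (F s)"
proof -
  \<comment> \<open>The zero vector is taken out since nothing pairs with it; \<open>r + s\<close>
    may well be zero.\<close>
  obtain z where z: "z \<in> zvecs (2*m)" "\<And>v. v \<in> {r, s, r + s} - {0} \<Longrightarrow> omega m v z \<noteq> 0"
    using omega_avoid[of "{r, s, r + s} - {0}" m] rs zvecs_add by blast
  have quasi0: "F (u + v) = op (F u) (F v)"
    if "u \<in> zvecs (2*m)" "v \<in> zvecs (2*m)" "u = 0 \<or> v = 0 \<or> omega m u v \<noteq> 0" for u v
    using that quasi zero by fastforce
  show ?thesis
  proof (cases "omega m r s = 0 \<and> r \<noteq> 0 \<and> s \<noteq> 0")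
    case False
    then show ?thesis using quasi0 rs by blast
  next
    case True
    have "op (F (r + s)) (F z) = F ((r + s) + z)"
      using quasi0[of "r + s" z] z rs zvecs_add by fastforce
    also have "\<dots> = F (r + (s + z))" by (simp add: add.assoc)
    \<comment> \<open>Here \<open>omega m r (s + z) = omega m r z\<close>, because \<open>r\<close>
      and \<open>s\<close> are orthogonal.\<close>
    also have "\<dots> = op (F r) (F (s + z))"
      using True z rs by (intro quasi0) (auto intro!: zvecs_add simp: omega_add_right)
    also have "F (s + z) = op (F s) (F z)"
      using True z rs by (intro quasi0) auto
    finally show ?thesis using cancel[OF z(1)] by (simp add: assoc)
  qed
qed

lemma additive_expand:
  fixes f :: "(nat \<Rightarrow> int) \<Rightarrow> int"
  assumes add: "\<And>r s. r \<in> zvecs N \<Longrightarrow> s \<in> zvecs N \<Longrightarrow> f (r + s) = f r + f s"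
    and r: "r \<in> zvecs N"
  shows "f r = (\<Sum>i<N. r i * f (unit_vec i))"
proof -
  have f0: "f 0 = 0" using add[of 0 0] by simp
  have fneg: "f (- r) = - f r" if "r \<in> zvecs N" for r
    using add[of r "- r"] that f0 by (simp add: zvecs_minus)
  have fnat: "f (\<lambda>i. int k * r i) = int k * f r" if "r \<in> zvecs N" for r k
  proof (induction k)
    case 0
    then show ?case using f0 by (simp add: zero_fun_def)
  next
    case (Suc k)
    have "(\<lambda>i. int (Suc k) * r i) = (\<lambda>i. int k * r i) + r" by (auto simp: algebra_simps fun_apply)
    then show ?case using add[of "\<lambda>i. int k * r i" r] Suc that
      by (simp add: zvecs_scale algebra_simps)
  qed
  have fint: "f (\<lambda>i. k * r i) = k * f r" if "r \<in> zvecs N" for r k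
  proof (cases "k \<ge> 0")
    case True
    then show ?thesis using fnat[OF that, of "nat k"] by simp
  next
    case False
    have "f (\<lambda>i. k * r i) = f (- (\<lambda>i. int (nat (- k)) * r i))"
      using False by (intro arg_cong[of _ _ f]) (auto simp: fun_apply)
    also have "\<dots> = - (int (nat (- k)) * f r)"
      by (simp only: fneg[OF zvecs_scale[OF that]] fnat[OF that])
    finally show ?thesis using False by simp
  qed
  \<comment> \<open>Additivity is available on the lattice only, so membership of the partial sums
    travels along in the induction.\<close>
  have fsum: "f (\<Sum>i\<in>A. g i) = (\<Sum>i\<in>A. f (g i)) \<and> (\<Sum>i\<in>A. g i) \<in> zvecs N"
    if "finite A" "\<And>i. i \<in> A \<Longrightarrow> g i \<in> zvecs N" for A :: "nat set" and g
    using that by (induction A rule: finite_induct) (auto simp: f0 add zvecs_add)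
  have "f r = f (\<Sum>i<N. (\<lambda>j. r i * unit_vec i j))" using zvecs_expand[OF r] by simp
  also have "\<dots> = (\<Sum>i<N. r i * f (unit_vec i))"
    using fsum[of "{..<N}" "\<lambda>i j. r i * unit_vec i j"]
    by (simp add: fint unit_vec_zvecs zvecs_scale)
  finally show ?thesis .
qed

section \<open>The derived algebra\<close>

text \<open>The elements of \<open>H'\<close> are Laurent polynomials modulo constants, under the Poisson bracket.\<close>

definition LP :: "nat \<Rightarrow> ((nat \<Rightarrow> int) \<Rightarrow> 'k::field) set" where
  "LP N = {c. finite {r. c r \<noteq> 0} \<and> {r. c r \<noteq> 0} \<subseteq> nzvecs N}"

definition hbasis :: "(nat \<Rightarrow> int) \<Rightarrow> (nat \<Rightarrow> int) \<Rightarrow> 'k::field" where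
  "hbasis r = (\<lambda>t. if t = r then 1 else 0)"

definition scl :: "'k::field \<Rightarrow> ('a \<Rightarrow> 'k) \<Rightarrow> 'a \<Rightarrow> 'k" where
  "scl a x = (\<lambda>r. a * x r)"

definition poisson :: "nat \<Rightarrow> ((nat \<Rightarrow> int) \<Rightarrow> 'k::field) \<Rightarrow> ((nat \<Rightarrow> int) \<Rightarrow> 'k) \<Rightarrow> (nat \<Rightarrow> int) \<Rightarrow> 'k" where
  "poisson m c1 c2 = (\<lambda>t. if t = 0 then 0 else
     \<Sum>r\<in>{r. c1 r \<noteq> 0}. c1 r * c2 (t - r) * of_int (omega m r (t - r)))"

definition lp_linear :: "nat \<Rightarrow> (((nat \<Rightarrow> int) \<Rightarrow> 'k::field) \<Rightarrow> ((nat \<Rightarrow> int) \<Rightarrow> 'k)) \<Rightarrow> bool" where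
  "lp_linear N f \<longleftrightarrow> f \<in> LP N \<rightarrow> LP N \<and> (\<forall>x\<in>LP N. \<forall>y\<in>LP N. f (x + y) = f x + f y) \<and>
     (\<forall>a. \<forall>x\<in>LP N. f (scl a x) = scl a (f x))"

definition lie_auto :: "nat \<Rightarrow> (((nat \<Rightarrow> int) \<Rightarrow> 'k::field) \<Rightarrow> ((nat \<Rightarrow> int) \<Rightarrow> 'k)) \<Rightarrow> bool" where
  "lie_auto m f \<longleftrightarrow> bij_betw f (LP (2*m)) (LP (2*m)) \<and> lp_linear (2*m) f \<and>
     (\<forall>x\<in>LP (2*m). \<forall>y\<in>LP (2*m). f (poisson m x y) = poisson m (f x) (f y))"

lemma LP_zero [simp]: "0 \<in> LP N" by (simp add: LP_def fun_apply)

lemma LP_finite: "x \<in> LP N \<Longrightarrow> finite {r. x r \<noteq> 0}" by (simp add: LP_def)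

lemma LP_supp: "x \<in> LP N \<Longrightarrow> x r \<noteq> 0 \<Longrightarrow> r \<in> nzvecs N" by (auto simp: LP_def)

lemma LP_at_zero: "x \<in> LP N \<Longrightarrow> x 0 = 0" using LP_supp by blast

lemma LP_I: "finite A \<Longrightarrow> A \<subseteq> nzvecs N \<Longrightarrow> (\<And>r. x r \<noteq> 0 \<Longrightarrow> r \<in> A) \<Longrightarrow> x \<in> LP N"
  unfolding LP_def using finite_subset[of "{r. x r \<noteq> 0}" A] by blast

lemma LP_add: "x \<in> LP N \<Longrightarrow> y \<in> LP N \<Longrightarrow> x + y \<in> LP N"
  by (rule LP_I[of "{r. x r \<noteq> 0} \<union> {r. y r \<noteq> 0}"]) (auto simp: LP_def fun_apply)

lemma LP_scl: "x \<in> LP N \<Longrightarrow> scl a x \<in> LP N"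
  by (rule LP_I[of "{r. x r \<noteq> 0}"]) (auto simp: LP_def scl_def)

lemma LP_hbasis: "r \<in> nzvecs N \<Longrightarrow> hbasis r \<in> LP N"
  by (rule LP_I[of "{r}"]) (auto simp: hbasis_def split: if_splits)

lemma hbasis_same [simp]: "hbasis r r = 1" by (simp add: hbasis_def)

lemma scl_one [simp]: "scl 1 x = x" by (simp add: scl_def)

lemma scl_zero: "scl 0 x = 0" by (simp add: scl_def fun_eq_iff fun_apply)

lemma scl_scl: "scl a (scl b x) = scl (a * b) x" by (simp add: scl_def algebra_simps)

text \<open>The defining sum runs over the exact support of the first argument. Comparing brackets
  of different elements requires a common index set.\<close>

lemma poisson_superset:
  assumes "finite A" "\<And>r. c1 r \<noteq> 0 \<Longrightarrow> r \<in> A"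
  shows "poisson m c1 c2 t =
    (if t = 0 then 0 else \<Sum>r\<in>A. c1 r * c2 (t - r) * of_int (omega m r (t - r)))"
  unfolding poisson_def using assms by (auto intro!: sum.mono_neutral_left)

lemma poisson_LP:
  assumes "x \<in> LP (2*m)" "y \<in> LP (2*m)"
  shows "poisson m x y \<in> LP (2*m)"
proof (rule LP_I)
  let ?A = "(\<lambda>(r, s). r + s) ` ({r. x r \<noteq> 0} \<times> {r. y r \<noteq> 0}) - {0}"
  show "finite ?A" using assms by (auto simp: LP_finite)
  show "?A \<subseteq> nzvecs (2*m)" using assms by (auto dest: LP_supp intro!: zvecs_add)
  fix t assume t: "poisson m x y t \<noteq> 0"
  then have "t \<noteq> 0" by (auto simp: poisson_def)
  with t have "(\<Sum>r\<in>{r. x r \<noteq> 0}. x r * y (t - r) * of_int (omega m r (t - r))) \<noteq> 0"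
    by (simp add: poisson_def)
  then obtain r where "x r * y (t - r) * of_int (omega m r (t - r)) \<noteq> 0"
    by (meson sum.not_neutral_contains_not_neutral)
  then show "t \<in> ?A" using \<open>t \<noteq> 0\<close> by (auto intro!: image_eqI[of _ _ "(r, t - r)"])
qed

lemma poisson_hbasis_left:
  "t \<noteq> 0 \<Longrightarrow> poisson m (hbasis r) c t = c (t - r) * of_int (omega m r (t - r))"
  by (subst poisson_superset[of "{r}"]) (auto simp: hbasis_def split: if_splits)

lemma poisson_hbasis_right:
  assumes "finite {r. c r \<noteq> 0}" "t \<noteq> 0"
  shows "poisson m c (hbasis s) t = c (t - s) * of_int (omega m (t - s) s)"
proof -
  have "poisson m c (hbasis s) t = (\<Sum>r\<in>insert (t - s) {r. c r \<noteq> 0}.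
      c r * hbasis s (t - r) * of_int (omega m r (t - r)))"
    using assms by (subst poisson_superset[of "insert (t - s) {r. c r \<noteq> 0}"]) auto
  also have "\<dots> = (\<Sum>r\<in>insert (t - s) {r. c r \<noteq> 0}.
      if r = t - s then c r * of_int (omega m r (t - r)) else 0)"
    by (rule sum.cong) (auto simp: hbasis_def algebra_simps)
  also have "\<dots> = c (t - s) * of_int (omega m (t - s) s)"
    using assms by simp
  finally show ?thesis .
qed

lemma poisson_hbasis_hbasis:
  "poisson m (hbasis r) (hbasis s) = scl (of_int (omega m r s)) (hbasis (r + s))"
proof
  fix t
  show "poisson m (hbasis r) (hbasis s) t = scl (of_int (omega m r s)) (hbasis (r + s)) t"
  proof (cases "t = 0")
    case True
    have "omega m r s = 0" if "r + s = 0"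
      using that by (simp add: add_eq_0_iff omega_minus_right)
    then show ?thesis using True by (auto simp: poisson_def scl_def hbasis_def)
  next
    case False
    then have "poisson m (hbasis r) (hbasis s) t = hbasis s (t - r) * of_int (omega m r (t - r))"
      by (rule poisson_hbasis_left)
    then show ?thesis by (auto simp: scl_def hbasis_def algebra_simps)
  qed
qed

lemma lp_linear_closed: "lp_linear N f \<Longrightarrow> x \<in> LP N \<Longrightarrow> f x \<in> LP N"
  by (auto simp: lp_linear_def)

lemma lp_linear_add: "lp_linear N f \<Longrightarrow> x \<in> LP N \<Longrightarrow> y \<in> LP N \<Longrightarrow> f (x + y) = f x + f y"
  by (auto simp: lp_linear_def)

lemma lp_linear_scl: "lp_linear N f \<Longrightarrow> x \<in> LP N \<Longrightarrow> f (scl a x) = scl a (f x)"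
  by (auto simp: lp_linear_def)

lemma lp_linear_zero: "lp_linear N f \<Longrightarrow> f 0 = 0"
  using lp_linear_scl[of N f 0 0] by (simp add: scl_zero)

lemma LP_induct [consumes 1, case_names zero add]:
  assumes "x \<in> LP N"
    and zero: "P 0"
    and add: "\<And>x a r. x \<in> LP N \<Longrightarrow> r \<in> nzvecs N \<Longrightarrow> P x \<Longrightarrow> P (x + scl a (hbasis r))"
  shows "P x"
proof -
  have "P x" if "finite A" "A \<subseteq> nzvecs N" "\<And>r. x r \<noteq> 0 \<Longrightarrow> r \<in> A" for A x
    using that
  proof (induction A arbitrary: x rule: finite_induct)
    case empty
    then have "x = 0" by (auto simp: fun_eq_iff fun_apply)
    then show ?case using zero by simp
  next
    case (insert r A)
    have "x = x(r := 0) + scl (x r) (hbasis r)"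
      by (rule ext) (auto simp: fun_apply scl_def hbasis_def)
    moreover have "P (x(r := 0))"
      by (rule insert.IH) (use insert.prems in \<open>auto split: if_splits\<close>)
    moreover have "x(r := 0) \<in> LP N"
      by (rule LP_I[of A]) (use insert in \<open>auto split: if_splits\<close>)
    ultimately show ?case using add[of "x(r := 0)" r "x r"] insert.prems by auto
  qed
  then show ?thesis using assms(1) by (auto simp: LP_def)
qed

lemma lp_linear_eqI:
  assumes "lp_linear N f" "lp_linear N g" "x \<in> LP N"
    and "\<And>r. r \<in> nzvecs N \<Longrightarrow> f (hbasis r) = g (hbasis r)"
  shows "f x = g x"
  using assms(3)
proof (induction rule: LP_induct)
  case zero
  show ?case using assms by (simp add: lp_linear_zero)
next
  case (add x a r)
  then show ?case using assms by (simp add: lp_linear_add lp_linear_scl LP_scl LP_hbasis)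
qed

lemma lp_linear_expand:
  assumes "lp_linear N f" "x \<in> LP N"
  shows "f x q = (\<Sum>r | x r \<noteq> 0. x r * f (hbasis r) q)"
proof -
  have "f x q = (\<Sum>r\<in>A. x r * f (hbasis r) q)"
    if "finite A" "A \<subseteq> nzvecs N" "\<And>r. x r \<noteq> 0 \<Longrightarrow> r \<in> A" for A x
    using that
  proof (induction A arbitrary: x rule: finite_induct)
    case empty
    then have "x = 0" by (auto simp: fun_eq_iff fun_apply)
    then show ?case by (simp add: lp_linear_zero[OF assms(1)]) (simp add: fun_apply)
  next
    case (insert r A)
    let ?y = "x(r := 0)"
    have y: "?y \<in> LP N"
      by (rule LP_I[of A]) (use insert in \<open>auto split: if_splits\<close>)
    have "f x = f (?y + scl (x r) (hbasis r))"
      by (intro arg_cong[of _ _ f] ext) (auto simp: fun_apply scl_def hbasis_def)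
    then have "f x q = f ?y q + x r * f (hbasis r) q"
      using assms(1) y insert.prems
      by (simp add: lp_linear_add lp_linear_scl LP_scl LP_hbasis) (simp add: fun_apply scl_def)
    also have "f ?y q = (\<Sum>s\<in>A. ?y s * f (hbasis s) q)"
      by (rule insert.IH) (use insert.prems in \<open>auto split: if_splits\<close>)
    also have "\<dots> = (\<Sum>s\<in>A. x s * f (hbasis s) q)"
      using insert.hyps by (intro sum.cong) auto
    finally show ?case using insert.hyps by simp
  qed
  then show ?thesis using assms(2) by (auto simp: LP_def)
qed

lemma lie_auto_bij: "lie_auto m f \<Longrightarrow> bij_betw f (LP (2*m)) (LP (2*m))"
  by (simp add: lie_auto_def)

lemma lie_auto_linear: "lie_auto m f \<Longrightarrow> lp_linear (2*m) f"
  by (simp add: lie_auto_def)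

lemma lie_auto_poisson:
  "lie_auto m f \<Longrightarrow> x \<in> LP (2*m) \<Longrightarrow> y \<in> LP (2*m) \<Longrightarrow> f (poisson m x y) = poisson m (f x) (f y)"
  by (simp add: lie_auto_def)

lemma lie_auto_inv:
  assumes f: "lie_auto m f"
  shows "lie_auto m (inv_into (LP (2*m)) f)"
proof -
  let ?L = "LP (2*m) :: ((nat \<Rightarrow> int) \<Rightarrow> 'a) set" and ?g = "inv_into (LP (2*m)) f"
  note bij = lie_auto_bij[OF f] and lin = lie_auto_linear[OF f]
  have g: "?g x \<in> ?L" "f (?g x) = x" if "x \<in> ?L" for x
    using bij that by (auto simp: bij_betw_def f_inv_into_f intro: inv_into_into)
  have eq: "?g x = y" if "y \<in> ?L" "f y = x" for x y
    using bij that by (auto simp: bij_betw_def inv_into_f_f)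
  show ?thesis
    unfolding lie_auto_def lp_linear_def
  proof (intro conjI ballI allI)
    show "bij_betw ?g ?L ?L" by (rule bij_betw_inv_into[OF bij])
    show "?g \<in> ?L \<rightarrow> ?L" using g by auto
    fix x y :: "(nat \<Rightarrow> int) \<Rightarrow> 'a" assume x: "x \<in> ?L" 
    show "?g (scl a x) = scl a (?g x)" for a
      using x g lin by (intro eq) (auto simp: LP_scl lp_linear_scl)
    assume y: "y \<in> ?L"
    show "?g (x + y) = ?g x + ?g y"
      using x y g lin by (intro eq) (auto simp: LP_add lp_linear_add)
    show "?g (poisson m x y) = poisson m (?g x) (?g y)"
      using x y g f by (intro eq) (auto simp: poisson_LP lie_auto_poisson)
  qed
qed

section \<open>Locally finite derivations\<close>

locale lp_derivation =
  fixes m :: nat and D :: "((nat \<Rightarrow> int) \<Rightarrow> 'k::field_char_0) \<Rightarrow> ((nat \<Rightarrow> int) \<Rightarrow> 'k)"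
  assumes linear: "lp_linear (2*m) D"
    and leibniz: "\<And>x y. x \<in> LP (2*m) \<Longrightarrow> y \<in> LP (2*m) \<Longrightarrow>
      D (poisson m x y) = poisson m (D x) y + poisson m x (D y)"
begin

text \<open>The homogeneous component of degree \<open>t\<close> sends \<open>h\<^sub>r\<close> to \<open>comp t r\<close> times \<open>h\<^bsub>r + t\<^esub>\<close>.\<close>

definition comp :: "(nat \<Rightarrow> int) \<Rightarrow> (nat \<Rightarrow> int) \<Rightarrow> 'k" where
  "comp t r = D (hbasis r) (r + t)"

text \<open>Degree zero is left out: it is the diagonal part, the one that is to survive.\<close>

definition degrees :: "(nat \<Rightarrow> int) set" where
  "degrees = {t \<in> nzvecs (2*m). \<exists>s\<in>nzvecs (2*m). comp t s \<noteq> 0}"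

lemma D_LP: "r \<in> nzvecs (2*m) \<Longrightarrow> D (hbasis r) \<in> LP (2*m)"
  by (rule lp_linear_closed[OF linear LP_hbasis])

text \<open>This is the coefficient of \<open>h_(r+s+t)\<close> in the Leibniz rule for
  \<open>[h_r, h_s]\<close>. Only components of the one degree \<open>t\<close> enter, so the
  degrees can be studied separately.\<close>

lemma comp_cocycle:
  assumes r: "r \<in> nzvecs (2*m)" and s: "s \<in> nzvecs (2*m)" and ne: "r + s + t \<noteq> 0"
  shows "of_int (omega m r s) * comp t (r + s) =
    of_int (omega m (r + t) s) * comp t r + of_int (omega m r (s + t)) * comp t s"
proof -
  let ?q = "r + s + t"
  have "D (poisson m (hbasis r) (hbasis s)) = scl (of_int (omega m r s)) (D (hbasis (r + s)))"
  proof (cases "r + s = 0")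
    case True
    \<comment> \<open>\<open>hbasis 0\<close> is not in \<open>LP\<close>, so linearity of
      \<open>D\<close> cannot be applied to it; the scalar in front vanishes instead.\<close>
    then have "omega m r s = 0" by (simp add: add_eq_0_iff omega_minus_right)
    then show ?thesis by (simp add: poisson_hbasis_hbasis scl_zero lp_linear_zero[OF linear])
  next
    case False
    then have "hbasis (r + s) \<in> (LP (2*m) :: (_ \<Rightarrow> 'k) set)"
      using r s by (intro LP_hbasis) (auto intro: zvecs_add)
    then show ?thesis by (simp add: poisson_hbasis_hbasis lp_linear_scl[OF linear])
  qed
  then have "of_int (omega m r s) * comp t (r + s) = D (poisson m (hbasis r) (hbasis s)) ?q"
    by (simp add: scl_def comp_def)
  also have "\<dots> = poisson m (D (hbasis r)) (hbasis s) ?q + poisson m (hbasis r) (D (hbasis s)) ?q"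
    using r s by (simp add: leibniz LP_hbasis plus_fun_apply)
  also have "poisson m (D (hbasis r)) (hbasis s) ?q = of_int (omega m (r + t) s) * comp t r"
  proof -
    have "?q - s = r + t" by simp
    then show ?thesis
      using poisson_hbasis_right[OF LP_finite[OF D_LP[OF r]] ne] by (simp add: comp_def)
  qed
  also have "poisson m (hbasis r) (D (hbasis s)) ?q = of_int (omega m r (s + t)) * comp t s"
  proof -
    have "?q - r = s + t" by simp
    then show ?thesis
      by (simp only: poisson_hbasis_left[OF ne] comp_def mult.commute)
  qed
  finally show ?thesis .
qed

text \<open>In the cocycle identity for the pair \<open>- t\<close>, \<open>s + t\<close>, the term
  with \<open>comp t (- t)\<close> carries the factor \<open>omega m 0 (s + t) = 0\<close>, and the
  two remaining factors both equal \<open>- omega m t s\<close>.\<close>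

lemma comp_shift:
  assumes t: "t \<in> zvecs (2*m)" and s: "s \<in> zvecs (2*m)" and ne: "omega m t s \<noteq> 0"
  shows "comp t (s + t) = comp t s"
proof -
  have nz: "- t \<noteq> 0" "s + t \<noteq> 0" using ne by (auto simp: omega_minus_right omega_minus_left add_eq_0_iff)
  have "of_int (omega m (- t) (s + t)) * comp t (- t + (s + t)) =
      of_int (omega m (- t + t) (s + t)) * comp t (- t) + of_int (omega m (- t) (s + t + t)) * comp t (s + t)"
    by (rule comp_cocycle) (use t s nz in \<open>auto intro: zvecs_add zvecs_minus\<close>)
  moreover have "- t + (s + t) = s" "- t + t = 0" by simp_all
  moreover have "omega m (- t) (s + t) = - omega m t s" "omega m (- t) (s + t + t) = - omega m t s"
    by (simp_all only: omega_bilinear omega_self)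
  ultimately have "of_int (omega m t s) * comp t s = of_int (omega m t s) * comp t (s + t)"
    by (simp only: omega_zero_left) simp
  then show ?thesis using ne by simp
qed

text \<open>By \<open>comp_shift\<close> the cocycle identities for \<open>(r, s)\<close> and
  \<open>(r, s + t)\<close> involve the same three values of \<open>comp t\<close>. Their difference
  gives additivity at \<open>r + s\<close>, and substituting this back gives the proportionality to
  \<open>omega m t\<close>, the eigenvalue pattern of \<open>ad h_t\<close>.\<close>

lemma comp_proportional_generic:
  assumes t: "t \<in> zvecs (2*m)" and r: "r \<in> zvecs (2*m)" and s: "s \<in> zvecs (2*m)"
    and ne: "omega m t r \<noteq> 0" "omega m t s \<noteq> 0" "omega m t (r + s) \<noteq> 0"
  shows "of_int (omega m t s) * comp t r = of_int (omega m t r) * comp t s"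
proof -
  have nz: "r \<noteq> 0" "s \<noteq> 0" "s + t \<noteq> 0"
    using ne by (auto simp: add_eq_0_iff omega_minus_right omega_minus_left)
  have nz': "r + s + t \<noteq> 0" "r + (s + t) + t \<noteq> 0"
  proof -
    have "omega m t (r + s + t) \<noteq> 0" "omega m t (r + (s + t) + t) \<noteq> 0"
      using ne(3) by (simp_all only: omega_add_right omega_self)
    then show "r + s + t \<noteq> 0" "r + (s + t) + t \<noteq> 0" by (metis omega_zero_right)+
  qed
  have sh: "comp t (s + t) = comp t s" "comp t (r + (s + t)) = comp t (r + s)"
    using comp_shift[of t s] comp_shift[of t "r + s"] t r s ne by (auto simp: zvecs_add add.assoc)
  define a b c where abc: "a = (of_int (omega m r s) :: 'k)" "b = (of_int (omega m t r) :: 'k)"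
    "c = (of_int (omega m t s) :: 'k)"
  have skew: "omega m r t = - omega m t r" by (rule omega_skew)
  have 1: "a * comp t (r + s) = (a + c) * comp t r + (a - b) * comp t s"
    using comp_cocycle[of r s t] r s nz nz' by (simp add: omega_bilinear skew abc)
  have 2: "(a - b) * comp t (r + s) = (a - b + c) * comp t r + (a - b - b) * comp t s"
  proof -
    have "omega m r (s + t) = omega m r s - omega m t r"
      "omega m (r + t) (s + t) = omega m r s - omega m t r + omega m t s"
      "omega m r (s + t + t) = omega m r s - omega m t r - omega m t r"
      by (simp_all only: omega_add_left omega_add_right skew omega_self)
    moreover have "of_int (omega m r (s + t)) * comp t (r + (s + t)) =
        of_int (omega m (r + t) (s + t)) * comp t r + of_int (omega m r (s + t + t)) * comp t (s + t)"
      by (rule comp_cocycle) (use r s t nz nz' in \<open>auto intro: zvecs_add\<close>)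
    ultimately show ?thesis by (simp only: sh of_int_add of_int_diff abc)
  qed
  have "b * comp t (r + s) = a * comp t (r + s) - (a - b) * comp t (r + s)"
    by (simp add: left_diff_distrib)
  also have "\<dots> = b * (comp t r + comp t s)" unfolding 1 2 by (simp add: algebra_simps)
  finally have "b * comp t (r + s) = b * (comp t r + comp t s)" .
  then have "comp t (r + s) = comp t r + comp t s" using ne by (simp add: abc)
  with 1 show ?thesis by (simp add: algebra_simps abc)
qed

text \<open>If \<open>r + s\<close> is orthogonal to \<open>t\<close>, both vectors are compared
  with \<open>s + s\<close>. The generic case applies because \<open>s + (s + s)\<close> and
  \<open>r + (s + s)\<close> pair with \<open>t\<close> to 3 and 1 times
  \<open>omega m t s\<close>.\<close>

lemma comp_proportional:
  assumes t: "t \<in> zvecs (2*m)" and r: "r \<in> zvecs (2*m)" and s: "s \<in> zvecs (2*m)"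
    and ne: "omega m t r \<noteq> 0" "omega m t s \<noteq> 0"
  shows "of_int (omega m t s) * comp t r = of_int (omega m t r) * comp t s"
proof (cases "omega m t (r + s) = 0")
  case False
  then show ?thesis using comp_proportional_generic assms by blast
next
  case True
  have ss: "s + s \<in> zvecs (2*m)" using s by (simp only: zvecs_add)
  have om: "omega m t (s + s) = 2 * omega m t s" "omega m t (s + (s + s)) = 3 * omega m t s"
    "omega m t (r + (s + s)) = omega m t s"
    using True by (simp_all only: omega_add_right)
  have "of_int (omega m t (s + s)) * comp t s = of_int (omega m t s) * comp t (s + s)"
    by (rule comp_proportional_generic[OF t s ss]) (use ne in \<open>simp_all only: om, simp_all\<close>)
  then have double: "comp t (s + s) = 2 * comp t s" using ne by (simp only: om) simp
  have "of_int (omega m t (s + s)) * comp t r = of_int (omega m t r) * comp t (s + s)"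
    by (rule comp_proportional_generic[OF t r ss]) (use ne in \<open>simp_all only: om, simp_all\<close>)
  then show ?thesis by (simp only: om double) simp
qed

text \<open>One zero off the hyperplane orthogonal to \<open>t\<close> kills \<open>comp t\<close>
  everywhere off it, by proportionality. A vector \<open>s\<close> on the hyperplane is split as
  \<open>(s - z) + z\<close> with both summands off it, and the cocycle identity carries the zero
  over to \<open>s\<close>.\<close>

lemma comp_nonzero:
  assumes t: "t \<in> degrees" and r: "r \<in> zvecs (2*m)" and ne: "omega m t r \<noteq> 0"
  shows "comp t r \<noteq> 0"
proof
  assume 0: "comp t r = 0"
  have tz: "t \<in> nzvecs (2*m)" using t by (simp add: degrees_def)
  have gen: "comp t s = 0" if "s \<in> zvecs (2*m)" "omega m t s \<noteq> 0" for s
    using comp_proportional[of t r s] tz r that ne 0 by auto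
  have "comp t s = 0" if s: "s \<in> nzvecs (2*m)" for s
  proof (cases "omega m t s = 0 \<and> s + t \<noteq> 0")
    case False
    \<comment> \<open>For \<open>s + t = 0\<close> the value \<open>comp t s\<close> is a
      coefficient at index zero, where elements of \<open>LP\<close> vanish.\<close>
    then show ?thesis using gen[of s] s LP_at_zero[OF D_LP[OF s]] by (cases "s + t = 0") (simp_all add: comp_def)
  next
    case True
    \<comment> \<open>Pairing with \<open>s\<close> must not vanish so that the left side of the
      cocycle identity survives; pairing with \<open>t\<close> must not vanish so that
      \<open>gen\<close> applies to \<open>z\<close> and \<open>s - z\<close>.\<close>
    obtain z where z: "z \<in> zvecs (2*m)" "\<And>v. v \<in> {s, t} \<Longrightarrow> omega m v z \<noteq> 0"
      using omega_avoid[of "{s, t}" m] s tz by auto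
    have nz: "s - z \<noteq> 0" "z \<noteq> 0" using z(2)[of s] by auto
    have "of_int (omega m (s - z) z) * comp t (s - z + z) =
        of_int (omega m (s - z + t) z) * comp t (s - z) + of_int (omega m (s - z) (z + t)) * comp t z"
      by (rule comp_cocycle) (use s z True nz in \<open>auto intro: zvecs_diff\<close>)
    moreover have "comp t (s - z) = 0" "comp t z = 0"
      using gen[of "s - z"] gen[of z] z s True by (simp_all add: zvecs_diff omega_diff_right)
    ultimately show ?thesis using z(2)[of s] by (simp add: omega_diff_left)
  qed
  then show False using t by (auto simp: degrees_def)
qed

text \<open>Each degree is nonorthogonal to some unit vector, hence visible in the image of that
  basis element. The \<open>2*m\<close> images involved have finite supports.\<close>

lemma finite_degrees: "finite degrees"
proof (rule finite_subset)
  let ?B = "\<Union>j<2*m. (\<lambda>p. p - unit_vec j) ` {p. D (hbasis (unit_vec j)) p \<noteq> 0}"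
  show "degrees \<subseteq> ?B"
  proof
    fix t assume t: "t \<in> degrees"
    then have "t \<in> nzvecs (2*m)" by (simp add: degrees_def)
    then obtain j where j: "j < 2*m" "omega m t (unit_vec j) \<noteq> 0" by (rule omega_nondegenerate)
    then have "comp t (unit_vec j) \<noteq> 0" using comp_nonzero[OF t] unit_vec_zvecs by blast
    then have "t \<in> (\<lambda>p. p - unit_vec j) ` {p. D (hbasis (unit_vec j)) p \<noteq> 0}"
      by (intro image_eqI[of _ _ "unit_vec j + t"]) (auto simp: comp_def)
    then show "t \<in> ?B" using j by blast
  qed
  show "finite ?B"
    by (intro finite_UN_I finite_imageI) (auto intro!: LP_finite[OF D_LP] simp: unit_vec_zvecs unit_vec_nonzero)
qed

text \<open>Along the ray \<open>s + k t\<close> the value of \<open>omega m t\<close> is constant,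
  so the shift never meets the orthogonal hyperplane.\<close>

lemma comp_shift_iterate:
  assumes t: "t \<in> zvecs (2*m)" and s: "s \<in> zvecs (2*m)" and ne: "omega m t s \<noteq> 0"
  shows "comp t (s + (\<lambda>i. int k * t i)) = comp t s"
proof (induction k)
  case 0
  have "s + (\<lambda>i. int 0 * t i) = s" by (auto simp: fun_eq_iff fun_apply)
  then show ?case by simp
next
  case (Suc k)
  have "s + (\<lambda>i. int (Suc k) * t i) = s + (\<lambda>i. int k * t i) + t"
    by (auto simp: fun_eq_iff fun_apply algebra_simps)
  moreover have "comp t (s + (\<lambda>i. int k * t i) + t) = comp t (s + (\<lambda>i. int k * t i))"
    using assms by (intro comp_shift) (auto simp: zvecs_add zvecs_scale omega_add_right omega_scale_right)
  ultimately show ?case using Suc by metis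
qed

text \<open>If some nonzero degree occurs, let \<open>t0\<close> be one of maximal Euclidean norm. By Cauchy-Schwarz it is
  the unique maximiser of \<open>(t0, _)\<close> among the degrees, so the iterates of a suitable basis vector
  \<open>h\<^sub>s\<close> have a nonvanishing leading coefficient at \<open>s + k t0\<close>, against local finiteness.\<close>

theorem locally_finite_imp_diagonal:
  assumes locfin: "\<And>s. s \<in> nzvecs (2*m) \<Longrightarrow>
      \<exists>B. finite B \<and> (\<forall>k q. (D ^^ k) (hbasis s) q \<noteq> 0 \<longrightarrow> q \<in> B)"
    and r: "r \<in> nzvecs (2*m)" and q: "D (hbasis r) q \<noteq> 0"
  shows "q = r"
proof (rule ccontr)
  assume "q \<noteq> r"
  have qz: "q \<in> zvecs (2*m)" using LP_supp[OF D_LP[OF r] q] by simp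
  have "q - r \<in> degrees"
    unfolding degrees_def using q r qz \<open>q \<noteq> r\<close> by (auto simp: comp_def zvecs_diff intro!: bexI[of _ r])
  then have ne: "degrees \<noteq> {}" by blast
  define nsq where "nsq t = (\<Sum>i<2*m. t i * t i)" for t :: "nat \<Rightarrow> int"
  have "Max (nsq ` degrees) \<in> nsq ` degrees" using ne finite_degrees by (intro Max_in) auto
  then obtain t0 where t0: "t0 \<in> degrees" "nsq t0 = Max (nsq ` degrees)" by auto
  have max: "nsq t \<le> nsq t0" if "t \<in> degrees" for t
    using that t0 finite_degrees by simp
  have t0z: "t0 \<in> nzvecs (2*m)" using t0 by (simp add: degrees_def)
  define \<phi> where "\<phi> t = (\<Sum>i<2*m. t0 i * t i)" for t
  have \<phi>_add: "\<phi> (x + y) = \<phi> x + \<phi> y" for x y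
    by (simp add: \<phi>_def fun_apply algebra_simps sum.distrib)
  have nsq_pos: "nsq v > 0" if v: "v \<in> nzvecs (2*m)" for v
  proof -
    obtain i where "i < 2*m" "v i \<noteq> 0" using v by (rule zvecs_nonzero_coord)
    then show ?thesis unfolding nsq_def by (intro sum_pos2[of _ i]) (auto simp: zero_less_mult_iff)
  qed
  have \<phi>_t0: "\<phi> t0 > 0" using nsq_pos[OF t0z] by (simp add: \<phi>_def nsq_def)
  \<comment> \<open>Strict Cauchy-Schwarz in the form \<open>nsq (t0 - t) > 0\<close>, combined with
    \<open>nsq t \<le> nsq t0 = \<phi> t0\<close>.\<close>
  have \<phi>_less: "\<phi> t < \<phi> t0" if "t \<in> degrees" "t \<noteq> t0" for t
  proof -
    have "t0 - t \<in> nzvecs (2*m)" using that t0z by (auto simp: degrees_def zvecs_diff)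
    then have "0 < nsq (t0 - t)" by (rule nsq_pos)
    also have "nsq (t0 - t) = nsq t0 + nsq t - 2 * \<phi> t"
      by (simp add: nsq_def \<phi>_def fun_apply algebra_simps sum.distrib sum_subtractf sum_distrib_left)
    also have "\<dots> \<le> 2 * \<phi> t0 - 2 * \<phi> t" using max[OF that(1)] by (simp add: nsq_def \<phi>_def)
    finally show ?thesis by simp
  qed
  obtain j where j: "j < 2*m" "omega m t0 (unit_vec j) \<noteq> 0" using omega_nondegenerate[OF t0z] .
  define s where "s = unit_vec j"
  have s: "s \<in> nzvecs (2*m)" "omega m t0 s \<noteq> 0"
    using j by (auto simp: s_def unit_vec_zvecs unit_vec_nonzero)
  define p where "p k = s + (\<lambda>i. int k * t0 i)" for k
  have p_Suc: "p (Suc k) = p k + t0" for k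
    by (auto simp: p_def fun_eq_iff fun_apply algebra_simps)
  have p0: "p 0 = s" by (auto simp: p_def fun_eq_iff fun_apply)
  have \<phi>_p: "\<phi> (p k) = \<phi> s + int k * \<phi> t0" for k
    by (induction k) (auto simp: p0 p_Suc \<phi>_add algebra_simps)
  have comp_p: "comp t0 (p k) = comp t0 s" for k
    unfolding p_def using s t0z by (intro comp_shift_iterate) auto
  \<comment> \<open>The invariant: \<open>p k\<close> is the only support point of maximal
    \<open>\<phi>\<close>, and its coefficient is a power of \<open>comp t0 s\<close>, because
    \<open>comp t0\<close> is constant along the ray.\<close>
  have iter: "(D ^^ k) (hbasis s) \<in> LP (2*m) \<and> (D ^^ k) (hbasis s) (p k) = comp t0 s ^ k \<and>
      (\<forall>q. (D ^^ k) (hbasis s) q \<noteq> 0 \<longrightarrow> q = p k \<or> \<phi> q < \<phi> (p k))" for k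
  proof (induction k)
    case 0
    have "hbasis s \<in> (LP (2*m) :: (_ \<Rightarrow> 'k) set)" using s by (intro LP_hbasis) auto
    then show ?case using s by (auto simp: p0 hbasis_def)
  next
    case (Suc k)
    define x where "x = (D ^^ k) (hbasis s)"
    have x: "x \<in> LP (2*m)" "x (p k) = comp t0 s ^ k" "\<And>q. x q \<noteq> 0 \<Longrightarrow> q = p k \<or> \<phi> q < \<phi> (p k)"
      using Suc by (auto simp: x_def)
    have Dx: "D x q = (\<Sum>r | x r \<noteq> 0. x r * D (hbasis r) q)" for q
      by (rule lp_linear_expand[OF linear x(1)])
    \<comment> \<open>One application of \<open>D\<close> raises \<open>\<phi>\<close> by at most
      \<open>\<phi> t0\<close>. The new maximum is reached only from the old leading point through
      degree \<open>t0\<close>, so no cancellation can occur there.\<close>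
    have bound: "q = p (Suc k) \<and> r = p k \<or> \<phi> q < \<phi> (p (Suc k))"
      if xr: "x r \<noteq> 0" and Dr: "D (hbasis r) q \<noteq> 0" for q r
    proof -
      have r: "r \<in> nzvecs (2*m)" using LP_supp[OF x(1) xr] .
      have q: "q \<in> nzvecs (2*m)" using LP_supp[OF D_LP[OF r] Dr] .
      define t where "t = q - r"
      have qt: "q = r + t" by (simp add: t_def)
      have "t = 0 \<or> t \<in> degrees"
        using q r Dr by (auto simp: t_def degrees_def comp_def zvecs_diff intro!: bexI[of _ r])
      then have t: "t = t0 \<or> \<phi> t < \<phi> t0"
        using \<phi>_less \<phi>_t0 by (auto simp: \<phi>_def fun_apply)
      show ?thesis using t x(3)[OF xr] by (auto simp: qt p_Suc \<phi>_add)
    qed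
    have "D x (p (Suc k)) = (\<Sum>r | x r \<noteq> 0. if r = p k then x (p k) * comp t0 s else 0)"
      unfolding Dx
    proof (intro sum.cong refl)
      fix r assume "r \<in> {r. x r \<noteq> 0}"
      then show "x r * D (hbasis r) (p (Suc k)) = (if r = p k then x (p k) * comp t0 s else 0)"
        using bound[of r "p (Suc k)"] comp_p[of k] by (auto simp: comp_def p_Suc)
    qed
    then have lead: "D x (p (Suc k)) = comp t0 s ^ Suc k"
      using LP_finite[OF x(1)] x(2) by simp
    have "q = p (Suc k) \<or> \<phi> q < \<phi> (p (Suc k))" if nz: "D x q \<noteq> 0" for q
    proof -
      obtain r where "x r * D (hbasis r) q \<noteq> 0"
        using nz unfolding Dx by (meson sum.not_neutral_contains_not_neutral)
      then show ?thesis using bound[of r q] by auto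
    qed
    then show ?case
      using lead lp_linear_closed[OF linear x(1)] by (simp add: x_def)
  qed
  obtain B where B: "finite B" "\<And>k q. (D ^^ k) (hbasis s) q \<noteq> 0 \<Longrightarrow> q \<in> B"
    using locfin[OF s(1)] by auto
  have "comp t0 s \<noteq> 0" using comp_nonzero[OF t0(1)] s by auto
  then have "p k \<in> B" for k using B(2)[of k "p k"] iter[of k] by auto
  then have "finite (range p)" using B(1) by (auto intro: finite_subset)
  moreover have "inj p"
  proof (rule injI)
    fix k l assume "p k = p l"
    then have "\<phi> (p k) = \<phi> (p l)" by simp
    then show "k = l" using \<phi>_t0 by (simp add: \<phi>_p)
  qed
  ultimately show False using finite_imageD by blast
qed

end

section \<open>Conformal symplectic matrices and characters of the lattice\<close>

text \<open>\<open>tv N Q r\<close> is \<open>Q\<^sup>T r\<close>, and \<open>gsign\<close> is only meaningful on \<open>GSp_Z\<close>.\<close>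

definition tv :: "nat \<Rightarrow> (nat \<Rightarrow> nat \<Rightarrow> int) \<Rightarrow> (nat \<Rightarrow> int) \<Rightarrow> nat \<Rightarrow> int" where
  "tv N Q r = (\<lambda>j. \<Sum>i<N. Q i j * r i)"

definition chr :: "nat \<Rightarrow> (nat \<Rightarrow> 'k::field) \<Rightarrow> (nat \<Rightarrow> int) \<Rightarrow> 'k" where
  "chr N a t = (\<Prod>i<N. a i powi t i)"

definition gsign :: "nat \<Rightarrow> (nat \<Rightarrow> nat \<Rightarrow> int) \<Rightarrow> int" where
  "gsign m Q = (if mat_mul (2*m) (mat_mul (2*m) (mat_T Q) (Jmat m)) Q = Jmat m then 1 else -1)"

lemma gsign_cases: "gsign m Q = 1 \<or> gsign m Q = -1"
  by (simp add: gsign_def)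

lemma gsign_square [simp]: "gsign m Q * gsign m Q = 1"
  by (simp add: gsign_def)

lemma mat_mul_assoc: "mat_mul N (mat_mul N A B) C = mat_mul N A (mat_mul N B C)"
proof (intro ext)
  fix i j
  have "mat_mul N (mat_mul N A B) C i j = (\<Sum>k<N. \<Sum>l<N. A i l * B l k * C k j)"
    by (simp add: mat_mul_def sum_distrib_right)
  also have "\<dots> = (\<Sum>l<N. \<Sum>k<N. A i l * B l k * C k j)" by (rule sum.swap)
  also have "\<dots> = mat_mul N A (mat_mul N B C) i j"
    by (simp add: mat_mul_def sum_distrib_left mult.assoc)
  finally show "mat_mul N (mat_mul N A B) C i j = mat_mul N A (mat_mul N B C) i j" .
qed

lemma mat_mul_intmats: "A \<in> intmats N \<Longrightarrow> B \<in> intmats N \<Longrightarrow> mat_mul N A B \<in> intmats N"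
  by (auto simp: intmats_def mat_mul_def)

lemma mat_id_intmats: "mat_id N \<in> intmats N"
  by (auto simp: intmats_def mat_id_def)

lemma mat_T_intmats: "A \<in> intmats N \<Longrightarrow> mat_T A \<in> intmats N"
  by (auto simp: intmats_def mat_T_def)

lemma Jmat_intmats: "Jmat m \<in> intmats (2*m)"
  by (auto simp: intmats_def Jmat_def)

lemma mat_mul_id_left: "A \<in> intmats N \<Longrightarrow> mat_mul N (mat_id N) A = A"
proof (intro ext)
  fix i j assume "A \<in> intmats N"
  moreover have "mat_mul N (mat_id N) A i j = (\<Sum>k<N. if k = i then A i j else 0)"
    unfolding mat_mul_def by (intro sum.cong) (auto simp: mat_id_def)
  ultimately show "mat_mul N (mat_id N) A i j = A i j" by (auto simp: intmats_def)
qed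

lemma mat_mul_id_right: "A \<in> intmats N \<Longrightarrow> mat_mul N A (mat_id N) = A"
proof (intro ext)
  fix i j assume "A \<in> intmats N"
  moreover have "mat_mul N A (mat_id N) i j = (\<Sum>k<N. if k = j then A i j else 0)"
    unfolding mat_mul_def by (intro sum.cong) (auto simp: mat_id_def)
  ultimately show "mat_mul N A (mat_id N) i j = A i j" by (auto simp: intmats_def)
qed

lemma mat_T_mul: "mat_T (mat_mul N A B) = mat_mul N (mat_T B) (mat_T A)"
  by (simp add: mat_T_def mat_mul_def mult.commute)

lemma mat_T_T [simp]: "mat_T (mat_T A) = A" by (simp add: mat_T_def)

lemma mat_T_id: "mat_T (mat_id N) = mat_id N" by (auto simp: mat_T_def mat_id_def fun_eq_iff)

lemma mat_mul_scale_left: "mat_mul N (\<lambda>i j. k * A i j) B = (\<lambda>i j. k * mat_mul N A B i j)"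
  by (simp add: mat_mul_def sum_distrib_left algebra_simps)

lemma mat_mul_scale_right: "mat_mul N A (\<lambda>i j. k * B i j) = (\<lambda>i j. k * mat_mul N A B i j)"
  by (simp add: mat_mul_def sum_distrib_left algebra_simps)

text \<open>\<open>Jmat\<close> is skew, so multiplying a row by it from the right gives minus
  \<open>J r\<close>. This is the source of the minus signs in the two translations between matrices
  and \<open>omega\<close> below.\<close>

lemma row_Jmat: "(\<Sum>l<2*m. r l * Jmat m l k) = - Jbar m r k"
proof -
  have "(\<Sum>l<2*m. r l * Jmat m l k) = (\<Sum>l<2*m. if l = (if k < m then k + m else k - m) \<and> k < 2*m
      then - Jbar m r k else 0)"
    by (intro sum.cong refl) (auto simp: Jmat_def Jbar_def)
  then show ?thesis by (auto simp: Jbar_def)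
qed

lemma Jmat_square: "mat_mul (2*m) (Jmat m) (Jmat m) = (\<lambda>i j. - 1 * mat_id (2*m) i j)"
proof (intro ext)
  fix i j
  have "mat_mul (2*m) (Jmat m) (Jmat m) i j = - Jbar m (Jmat m i) j"
    unfolding mat_mul_def by (rule row_Jmat)
  then show "mat_mul (2*m) (Jmat m) (Jmat m) i j = - 1 * mat_id (2*m) i j"
    by (auto simp: Jbar_def Jmat_def mat_id_def)
qed

text \<open>The rows of \<open>Q\<close> are the images of the unit vectors under
  \<open>Q^T\<close>. Hence the form on images is governed by \<open>Q J Q^T\<close>, whereas
  \<open>GSp_Z\<close> is defined through \<open>Q^T J Q\<close>; \<open>conformal_transpose\<close>
  bridges the two.\<close>

lemma omega_congruence_matrix:
  "mat_mul (2*m) (mat_mul (2*m) Q (Jmat m)) (mat_T Q) i j = - omega m (Q i) (Q j)"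
  by (simp add: mat_mul_def row_Jmat mat_T_def omega_def ipairing_def sum_negf)

lemma Jmat_eq_omega: "i < 2*m \<Longrightarrow> j < 2*m \<Longrightarrow> Jmat m i j = - omega m (unit_vec i) (unit_vec j)"
proof (cases "j < m")
  case True
  then have "omega m (unit_vec i) (unit_vec j) = unit_vec i (j + m)" by (rule omega_unit_right)
  then show ?thesis using True by (auto simp: Jmat_def unit_vec_def)
next
  case False
  moreover assume "j < 2*m"
  ultimately have "omega m (unit_vec i) (unit_vec j) = - unit_vec i (j - m)"
    using omega_unit_right(2)[of "j - m" m "unit_vec i"] by simp
  then show ?thesis using False \<open>j < 2*m\<close> by (auto simp: Jmat_def unit_vec_def)
qed

lemma GL_Z_obtain_inverse:
  assumes "Q \<in> GL_Z N"
  obtains Q' where "Q' \<in> GL_Z N" "mat_mul N Q Q' = mat_id N" "mat_mul N Q' Q = mat_id N"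
  using assms by (auto simp: GL_Z_def)

lemma GL_Z_intmats: "Q \<in> GL_Z N \<Longrightarrow> Q \<in> intmats N" by (simp add: GL_Z_def)

lemma GL_Z_mat_T: "Q \<in> GL_Z N \<Longrightarrow> mat_T Q \<in> GL_Z N"
proof -
  assume Q: "Q \<in> GL_Z N"
  then obtain Q' where Q': "Q' \<in> GL_Z N" "mat_mul N Q Q' = mat_id N" "mat_mul N Q' Q = mat_id N"
    by (rule GL_Z_obtain_inverse)
  have "mat_mul N (mat_T Q) (mat_T Q') = mat_id N" "mat_mul N (mat_T Q') (mat_T Q) = mat_id N"
    by (simp_all add: mat_T_mul[symmetric] Q' mat_T_id)
  then show ?thesis
    unfolding GL_Z_def using Q Q'(1)
    by (auto simp: mat_T_intmats GL_Z_intmats intro!: bexI[of _ "mat_T Q'"])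
qed

lemma GL_Z_mul:
  assumes "A \<in> GL_Z N" "B \<in> GL_Z N"
  shows "mat_mul N A B \<in> GL_Z N"
proof -
  obtain A' where A': "A' \<in> GL_Z N" "mat_mul N A A' = mat_id N" "mat_mul N A' A = mat_id N"
    using assms(1) by (rule GL_Z_obtain_inverse)
  obtain B' where B': "B' \<in> GL_Z N" "mat_mul N B B' = mat_id N" "mat_mul N B' B = mat_id N"
    using assms(2) by (rule GL_Z_obtain_inverse)
  note mats = assms[THEN GL_Z_intmats] A'(1)[THEN GL_Z_intmats] B'(1)[THEN GL_Z_intmats]
  have "mat_mul N (mat_mul N A B) (mat_mul N B' A') = mat_mul N A (mat_mul N (mat_mul N B B') A')"
    by (simp only: mat_mul_assoc)
  moreover have "mat_mul N (mat_mul N B' A') (mat_mul N A B) = mat_mul N B' (mat_mul N (mat_mul N A' A) B)"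
    by (simp only: mat_mul_assoc)
  ultimately show ?thesis
    unfolding GL_Z_def using mats A' B'
    by (auto simp: mat_mul_intmats mat_mul_id_left intro!: bexI[of _ "mat_mul N B' A'"])
qed

text \<open>Multiply \<open>Q\<^sup>T J Q = e J\<close> on the left by the inverse of \<open>Q\<^sup>T\<close> and on the right by \<open>J Q\<^sup>T\<close>.\<close>

lemma conformal_transpose:
  assumes Q: "Q \<in> GL_Z (2*m)"
    and sp: "mat_mul (2*m) (mat_mul (2*m) (mat_T Q) (Jmat m)) Q = (\<lambda>i j. e * Jmat m i j)"
  shows "mat_mul (2*m) (mat_mul (2*m) Q (Jmat m)) (mat_T Q) = (\<lambda>i j. e * Jmat m i j)"
proof -
  let ?M = "mat_mul (2*m)" and ?J = "Jmat m"
  obtain Q' where Q': "Q' \<in> GL_Z (2*m)" "?M Q Q' = mat_id (2*m)" "?M Q' Q = mat_id (2*m)"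
    using Q by (rule GL_Z_obtain_inverse)
  let ?T = "mat_T Q" and ?T' = "mat_T Q'"
  note mats = Q[THEN GL_Z_intmats] Q'(1)[THEN GL_Z_intmats]
  have T'T: "?M ?T' ?T = mat_id (2*m)" using Q'(2) by (metis mat_T_id mat_T_mul)
  have "?M ?J Q = ?M (?M ?T' ?T) (?M ?J Q)"
    using mats by (simp add: T'T mat_mul_id_left mat_mul_intmats Jmat_intmats)
  also have "\<dots> = ?M ?T' (?M (?M ?T ?J) Q)" by (simp only: mat_mul_assoc)
  also have "\<dots> = (\<lambda>i j. e * ?M ?T' ?J i j)" by (simp only: sp mat_mul_scale_right)
  finally have JQ: "?M ?J Q = (\<lambda>i j. e * ?M ?T' ?J i j)" .
  have "?M (?M ?J Q) (?M ?J ?T) = (\<lambda>i j. e * ?M ?T' (?M (?M ?J ?J) ?T) i j)"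
    by (simp only: JQ mat_mul_scale_left mat_mul_assoc)
  also have "\<dots> = (\<lambda>i j. - e * mat_id (2*m) i j)"
    using mats by (simp add: Jmat_square mat_mul_scale_left[of _ "-1", simplified]
        mat_mul_scale_right[of _ _ "-1", simplified] mat_mul_id_left mat_T_intmats T'T)
  \<comment> \<open>At this point \<open>J Q J Q^T = - e I\<close>. One more \<open>J\<close> on the
    left, with \<open>J J = - I\<close>, isolates \<open>Q J Q^T\<close>.\<close>
  finally have "?M (?M ?J ?J) (?M (?M Q ?J) ?T) = ?M ?J (\<lambda>i j. - e * mat_id (2*m) i j)"
    by (simp only: mat_mul_assoc)
  then have "(\<lambda>i j. - ?M (?M Q ?J) ?T i j) = (\<lambda>i j. - e * ?J i j)"
    using mats by (simp only: Jmat_square mat_mul_scale_left mat_mul_scale_right mat_mul_id_right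
        Jmat_intmats mat_mul_id_left mat_mul_intmats mat_T_intmats) simp
  then show ?thesis by (simp add: fun_eq_iff)
qed

lemma tv_zvecs: "Q \<in> intmats N \<Longrightarrow> tv N Q r \<in> zvecs N"
  by (auto simp: tv_def zvecs_def intmats_def)

lemma tv_add: "tv N Q (r + s) = tv N Q r + tv N Q s"
  by (rule ext) (simp add: tv_def fun_apply algebra_simps sum.distrib)

lemma tv_diff: "tv N Q (r - s) = tv N Q r - tv N Q s"
  by (rule ext) (simp add: tv_def fun_apply algebra_simps sum_subtractf)

lemma tv_zero [simp]: "tv N Q 0 = 0"
  by (rule ext) (simp add: tv_def fun_apply)

lemma tv_unit: "i < N \<Longrightarrow> tv N Q (unit_vec i) = Q i"
proof
  fix j assume "i < N"
  moreover have "tv N Q (unit_vec i) j = (\<Sum>l<N. if l = i then Q i j else 0)"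
    unfolding tv_def by (intro sum.cong) (auto simp: unit_vec_def)
  ultimately show "tv N Q (unit_vec i) j = Q i j" by simp
qed

lemma tv_mul: "tv N (mat_mul N A B) r = tv N B (tv N A r)"
proof
  fix j
  have "tv N (mat_mul N A B) r j = (\<Sum>i<N. \<Sum>k<N. A i k * B k j * r i)"
    by (simp add: tv_def mat_mul_def sum_distrib_right)
  also have "\<dots> = (\<Sum>k<N. \<Sum>i<N. A i k * B k j * r i)" by (rule sum.swap)
  also have "\<dots> = tv N B (tv N A r) j"
    by (simp add: tv_def sum_distrib_left algebra_simps)
  finally show "tv N (mat_mul N A B) r j = tv N B (tv N A r) j" .
qed

lemma tv_id: "r \<in> zvecs N \<Longrightarrow> tv N (mat_id N) r = r"
proof
  fix j assume "r \<in> zvecs N"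
  moreover have "tv N (mat_id N) r j = (\<Sum>i<N. if i = j then r j else 0)"
    unfolding tv_def by (intro sum.cong) (auto simp: mat_id_def)
  ultimately show "tv N (mat_id N) r j = r j" by (auto simp: zvecs_def)
qed

lemma intmats_eqI:
  assumes "A \<in> intmats N" "B \<in> intmats N" "\<And>i. i < N \<Longrightarrow> A i = B i"
  shows "A = B"
proof
  fix i show "A i = B i"
    using assms by (cases "i < N") (auto simp: intmats_def fun_eq_iff)
qed

lemma biadditive_eqI:
  fixes f g :: "(nat \<Rightarrow> int) \<Rightarrow> (nat \<Rightarrow> int) \<Rightarrow> int"
  assumes f: "\<And>r r' s. r \<in> zvecs N \<Longrightarrow> r' \<in> zvecs N \<Longrightarrow> s \<in> zvecs N \<Longrightarrow> f (r + r') s = f r s + f r' s"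
      "\<And>r s s'. r \<in> zvecs N \<Longrightarrow> s \<in> zvecs N \<Longrightarrow> s' \<in> zvecs N \<Longrightarrow> f r (s + s') = f r s + f r s'"
    and g: "\<And>r r' s. r \<in> zvecs N \<Longrightarrow> r' \<in> zvecs N \<Longrightarrow> s \<in> zvecs N \<Longrightarrow> g (r + r') s = g r s + g r' s"
      "\<And>r s s'. r \<in> zvecs N \<Longrightarrow> s \<in> zvecs N \<Longrightarrow> s' \<in> zvecs N \<Longrightarrow> g r (s + s') = g r s + g r s'"
    and eq: "\<And>i j. i < N \<Longrightarrow> j < N \<Longrightarrow> f (unit_vec i) (unit_vec j) = g (unit_vec i) (unit_vec j)"
    and rs: "r \<in> zvecs N" "s \<in> zvecs N"
  shows "f r s = g r s"
proof -
  have unit: "f (unit_vec i) s = g (unit_vec i) s" if "i < N" for i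
    using additive_expand[of N "f (unit_vec i)" s] additive_expand[of N "g (unit_vec i)" s] that rs
    by (simp add: f g eq unit_vec_zvecs)
  show ?thesis
    using additive_expand[of N "\<lambda>r. f r s" r] additive_expand[of N "\<lambda>r. g r s" r] rs
    by (simp add: f g unit unit_vec_zvecs)
qed

lemma conformal_iff_omega:
  assumes Q: "Q \<in> intmats (2*m)"
  shows "mat_mul (2*m) (mat_mul (2*m) Q (Jmat m)) (mat_T Q) = (\<lambda>i j. e * Jmat m i j) \<longleftrightarrow>
    (\<forall>r\<in>zvecs (2*m). \<forall>s\<in>zvecs (2*m). omega m (tv (2*m) Q r) (tv (2*m) Q s) = e * omega m r s)"
    (is "?L = (\<lambda>i j. e * Jmat m i j) \<longleftrightarrow> ?R")
proof
  assume L: "?L = (\<lambda>i j. e * Jmat m i j)"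
  have unit: "omega m (tv (2*m) Q (unit_vec i)) (tv (2*m) Q (unit_vec j)) =
      e * omega m (unit_vec i) (unit_vec j)" if "i < 2*m" "j < 2*m" for i j
    using fun_cong[OF fun_cong[OF L], of i j] that
    by (simp add: omega_congruence_matrix Jmat_eq_omega tv_unit)
  show ?R
  proof (intro ballI)
    fix r s assume rs: "r \<in> zvecs (2*m)" "s \<in> zvecs (2*m)"
    show "omega m (tv (2*m) Q r) (tv (2*m) Q s) = e * omega m r s"
      by (rule biadditive_eqI[of "2*m" "\<lambda>r s. omega m (tv (2*m) Q r) (tv (2*m) Q s)"
          "\<lambda>r s. e * omega m r s", OF _ _ _ _ unit rs])
        (simp_all add: tv_add omega_add_left omega_add_right distrib_left)
  qed
next
  assume R: ?R
  show "?L = (\<lambda>i j. e * Jmat m i j)"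
  proof (intro ext)
    fix i j
    show "?L i j = e * Jmat m i j"
    proof (cases "i < 2*m \<and> j < 2*m")
      case True
      then show ?thesis
        using bspec[OF bspec[OF R, of "unit_vec i"], of "unit_vec j"]
        by (simp add: omega_congruence_matrix Jmat_eq_omega tv_unit unit_vec_zvecs)
    next
      case False
      then have "?L i j = 0" "Jmat m i j = 0"
        using mat_mul_intmats[OF mat_mul_intmats[OF Q Jmat_intmats] mat_T_intmats[OF Q]] Jmat_intmats[of m]
        by (auto simp: intmats_def)
      then show ?thesis by simp
    qed
  qed
qed

lemma GSp_Z_GL: "Q \<in> GSp_Z m \<Longrightarrow> Q \<in> GL_Z (2*m)" by (simp add: GSp_Z_def)

lemma GSp_Z_intmats: "Q \<in> GSp_Z m \<Longrightarrow> Q \<in> intmats (2*m)" by (simp add: GSp_Z_def GL_Z_def)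

lemma GSp_Z_omega:
  assumes Q: "Q \<in> GSp_Z m" and "r \<in> zvecs (2*m)" "s \<in> zvecs (2*m)"
  shows "omega m (tv (2*m) Q r) (tv (2*m) Q s) = gsign m Q * omega m r s"
proof -
  have "mat_mul (2*m) (mat_mul (2*m) (mat_T Q) (Jmat m)) Q = (\<lambda>i j. gsign m Q * Jmat m i j)"
    using Q by (auto simp: GSp_Z_def gsign_def)
  from conformal_transpose[OF GSp_Z_GL[OF Q] this] show ?thesis
    using conformal_iff_omega[OF GSp_Z_intmats[OF Q]] assms by blast
qed

lemma GSp_Z_I:
  assumes Q: "Q \<in> GL_Z (2*m)" and e: "e = 1 \<or> e = - 1"
    and om: "\<And>r s. r \<in> zvecs (2*m) \<Longrightarrow> s \<in> zvecs (2*m) \<Longrightarrow>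
      omega m (tv (2*m) Q r) (tv (2*m) Q s) = e * omega m r s"
  shows "Q \<in> GSp_Z m"
proof -
  have "mat_mul (2*m) (mat_mul (2*m) Q (Jmat m)) (mat_T Q) = (\<lambda>i j. e * Jmat m i j)"
    using conformal_iff_omega[OF GL_Z_intmats[OF Q]] om by blast
  then have "mat_mul (2*m) (mat_mul (2*m) (mat_T Q) (Jmat m)) Q = (\<lambda>i j. e * Jmat m i j)"
    using conformal_transpose[OF GL_Z_mat_T[OF Q]] by simp
  then show ?thesis using Q e by (auto simp: GSp_Z_def)
qed

lemma omega_unit_one: "m \<ge> 1 \<Longrightarrow> omega m (unit_vec m) (unit_vec 0) = 1"
  using omega_unit_right(1)[of 0 m "unit_vec m"] by (simp add: unit_vec_def)

text \<open>For \<open>m \<ge> 1\<close> some pair of lattice vectors has form 1, so the scaling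
  factor is determined by what \<open>Q\<close> does to the form.\<close>

lemma gsign_eqI:
  assumes m: "m \<ge> 1" and Q: "Q \<in> GSp_Z m"
    and om: "\<And>r s. r \<in> zvecs (2*m) \<Longrightarrow> s \<in> zvecs (2*m) \<Longrightarrow>
      omega m (tv (2*m) Q r) (tv (2*m) Q s) = e * omega m r s"
  shows "gsign m Q = e"
  using om[of "unit_vec m" "unit_vec 0"] GSp_Z_omega[OF Q, of "unit_vec m" "unit_vec 0"]
    omega_unit_one[OF m] m by (simp add: unit_vec_zvecs)

lemma GSp_Z_mul:
  assumes "A \<in> GSp_Z m" "B \<in> GSp_Z m"
  shows "mat_mul (2*m) A B \<in> GSp_Z m"
    and "m \<ge> 1 \<Longrightarrow> gsign m (mat_mul (2*m) A B) = gsign m A * gsign m B"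
proof -
  have om: "omega m (tv (2*m) (mat_mul (2*m) A B) r) (tv (2*m) (mat_mul (2*m) A B) s) =
      gsign m A * gsign m B * omega m r s" if "r \<in> zvecs (2*m)" "s \<in> zvecs (2*m)" for r s
    using assms that by (simp add: tv_mul GSp_Z_omega tv_zvecs GSp_Z_intmats)
  show in_GSp: "mat_mul (2*m) A B \<in> GSp_Z m"
  proof (rule GSp_Z_I[OF _ _ om])
    show "gsign m A * gsign m B = 1 \<or> gsign m A * gsign m B = - 1"
      using gsign_cases[of m A] gsign_cases[of m B] by auto
  qed (use assms in \<open>auto intro: GL_Z_mul GSp_Z_GL\<close>)
  show "gsign m (mat_mul (2*m) A B) = gsign m A * gsign m B" if "m \<ge> 1"
    by (rule gsign_eqI[OF that in_GSp om])
qed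

lemma gsign_id: "gsign m (mat_id (2*m)) = 1"
  by (simp add: gsign_def mat_T_id mat_mul_id_left mat_mul_id_right Jmat_intmats)

lemma GSp_Z_obtain_inverse:
  assumes Q: "Q \<in> GSp_Z m"
  obtains Q' where "Q' \<in> GSp_Z m" "mat_mul (2*m) Q Q' = mat_id (2*m)" "mat_mul (2*m) Q' Q = mat_id (2*m)"
proof -
  obtain Q' where Q': "Q' \<in> GL_Z (2*m)" "mat_mul (2*m) Q Q' = mat_id (2*m)"
      "mat_mul (2*m) Q' Q = mat_id (2*m)"
    using GSp_Z_GL[OF Q] by (rule GL_Z_obtain_inverse)
  have inv: "tv (2*m) Q (tv (2*m) Q' r) = r" if "r \<in> zvecs (2*m)" for r
    using that by (simp add: tv_mul[symmetric] Q' tv_id)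
  have "omega m (tv (2*m) Q' r) (tv (2*m) Q' s) = gsign m Q * omega m r s"
    if rs: "r \<in> zvecs (2*m)" "s \<in> zvecs (2*m)" for r s
  proof -
    have "omega m r s = gsign m Q * omega m (tv (2*m) Q' r) (tv (2*m) Q' s)"
      using GSp_Z_omega[OF Q, of "tv (2*m) Q' r" "tv (2*m) Q' s"] rs Q'(1)
      by (simp add: inv tv_zvecs GL_Z_intmats)
    then show ?thesis by (simp add: mult.assoc[symmetric])
  qed
  then have "Q' \<in> GSp_Z m" by (rule GSp_Z_I[OF Q'(1) gsign_cases])
  then show ?thesis using that Q' by blast
qed

section \<open>Characters of the lattice and points of the torus\<close>

lemma chr_add: "a \<in> torus N \<Longrightarrow> chr N a (s + t) = chr N a s * chr N a t"
  unfolding chr_def prod.distrib[symmetric]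
  by (intro prod.cong) (auto simp: torus_def fun_apply power_int_add)

lemma chr_nonzero: "a \<in> torus N \<Longrightarrow> chr N a t \<noteq> 0"
  by (auto simp: chr_def torus_def)

lemma chr_unit: "i < N \<Longrightarrow> chr N a (unit_vec i) = a i"
proof -
  assume i: "i < N"
  have "chr N a (unit_vec i) = (\<Prod>j<N. if j = i then a i else 1)"
    unfolding chr_def by (intro prod.cong) (auto simp: unit_vec_def)
  then show ?thesis using i by simp
qed

lemma chr_mult: "chr N (\<lambda>i. a i * b i) t = chr N a t * chr N b t"
  by (simp add: chr_def power_int_mult_distrib prod.distrib)

lemma chr_one [simp]: "chr N (\<lambda>_. 1) t = 1" by (simp add: chr_def)

lemma powi_sum:
  fixes x :: "'k::field"
  shows "x \<noteq> 0 \<Longrightarrow> x powi (\<Sum>i\<in>A. f i) = (\<Prod>i\<in>A. x powi f i)"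
  by (induction A rule: infinite_finite_induct) (auto simp: power_int_add)

lemma powi_prod:
  fixes f :: "_ \<Rightarrow> 'k::field"
  shows "(\<Prod>i\<in>A. f i) powi n = (\<Prod>i\<in>A. f i powi n)"
  by (induction A rule: infinite_finite_induct) (auto simp: power_int_mult_distrib)

text \<open>Exchanging the two products moves \<open>Q\<close> from the torus point to the exponent.
  Through this identity every equation between twisted torus elements is checked on
  characters.\<close>

lemma chr_torus_act:
  assumes "a \<in> torus N"
  shows "chr N (torus_act N Q a) t = chr N a (tv N Q t)"
proof -
  have "chr N (torus_act N Q a) t = (\<Prod>j<N. \<Prod>i<N. a i powi (Q j i * t j))"
    by (simp add: chr_def torus_act_def powi_prod power_int_mult)
  also have "\<dots> = (\<Prod>i<N. \<Prod>j<N. a i powi (Q j i * t j))" by (rule prod.swap)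
  also have "\<dots> = chr N a (tv N Q t)"
    unfolding chr_def tv_def
    by (intro prod.cong refl powi_sum[symmetric]) (use assms in \<open>auto simp: torus_def\<close>)
  finally show ?thesis .
qed

lemma torus_act_torus: "a \<in> torus N \<Longrightarrow> torus_act N Q a \<in> torus N"
  by (auto simp: torus_def torus_act_def)

lemma torus_mult: "a \<in> torus N \<Longrightarrow> b \<in> torus N \<Longrightarrow> (\<lambda>i. a i * b i) \<in> torus N"
  by (auto simp: torus_def)

lemma torus_inverse: "a \<in> torus N \<Longrightarrow> (\<lambda>i. inverse (a i)) \<in> torus N"
  by (auto simp: torus_def)

lemma torus_eqI:
  assumes "a \<in> torus N" "b \<in> torus N" "\<And>t. t \<in> nzvecs N \<Longrightarrow> chr N a t = chr N b t"
  shows "a = b"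
proof
  fix i show "a i = b i"
  proof (cases "i < N")
    case True
    then show ?thesis using assms(3)[of "unit_vec i"]
      by (simp add: chr_unit unit_vec_zvecs unit_vec_nonzero)
  next
    case False
    then show ?thesis using assms by (simp add: torus_def)
  qed
qed

text \<open>Every character of the lattice comes from a torus point, whose coordinates are its
  values at the unit vectors. Nonvanishing is what gives meaning to negative exponents.\<close>

lemma multiplicative_expand:
  fixes f :: "(nat \<Rightarrow> int) \<Rightarrow> 'k::field"
  assumes mult: "\<And>r s. r \<in> zvecs N \<Longrightarrow> s \<in> zvecs N \<Longrightarrow> f (r + s) = f r * f s"
    and nz: "\<And>r. r \<in> zvecs N \<Longrightarrow> f r \<noteq> 0"
    and r: "r \<in> zvecs N"
  shows "f r = chr N (\<lambda>i. f (unit_vec i)) r"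
proof -
  have f0: "f 0 = 1" using mult[of 0 0] nz[of 0] by simp
  have fneg: "f (- r) = inverse (f r)" if "r \<in> zvecs N" for r
    using mult[of r "- r"] that f0 nz[OF that] by (simp add: zvecs_minus field_simps)
  have fnat: "f (\<lambda>i. int k * r i) = f r ^ k" if "r \<in> zvecs N" for r k
  proof (induction k)
    case 0
    then show ?case using f0 by (simp add: zero_fun_def)
  next
    case (Suc k)
    have "(\<lambda>i. int (Suc k) * r i) = (\<lambda>i. int k * r i) + r" by (auto simp: algebra_simps fun_apply)
    then show ?case using mult[of "\<lambda>i. int k * r i" r] Suc that
      by (simp add: zvecs_scale algebra_simps)
  qed
  have fint: "f (\<lambda>i. k * r i) = f r powi k" if "r \<in> zvecs N" for r k
  proof (cases "k \<ge> 0")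
    case True
    then show ?thesis using fnat[OF that, of "nat k"] by (simp add: power_int_def)
  next
    case False
    have "f (\<lambda>i. k * r i) = f (- (\<lambda>i. int (nat (- k)) * r i))"
      using False by (intro arg_cong[of _ _ f]) (auto simp: fun_apply)
    also have "\<dots> = inverse (f r ^ nat (- k))"
      by (simp only: fneg[OF zvecs_scale[OF that]] fnat[OF that])
    finally show ?thesis using False by (simp add: power_int_def power_inverse)
  qed
  have fsum: "f (\<Sum>i\<in>A. g i) = (\<Prod>i\<in>A. f (g i)) \<and> (\<Sum>i\<in>A. g i) \<in> zvecs N"
    if "finite A" "\<And>i. i \<in> A \<Longrightarrow> g i \<in> zvecs N" for A :: "nat set" and g
    using that by (induction A rule: finite_induct) (auto simp: f0 mult zvecs_add)
  have "f r = f (\<Sum>i<N. (\<lambda>j. r i * unit_vec i j))" using zvecs_expand[OF r] by simp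
  also have "\<dots> = chr N (\<lambda>i. f (unit_vec i)) r"
    using fsum[of "{..<N}" "\<lambda>i j. r i * unit_vec i j"]
    by (simp add: fint unit_vec_zvecs zvecs_scale chr_def)
  finally show ?thesis .
qed

section \<open>Automorphisms of the derived algebra\<close>

text \<open>The adjoint action of \<open>d_i\<close> on \<open>H'\<close>. It obeys the Leibniz rule
  because indices add under the bracket.\<close>

definition coord_deriv :: "nat \<Rightarrow> ((nat \<Rightarrow> int) \<Rightarrow> 'k::field) \<Rightarrow> ((nat \<Rightarrow> int) \<Rightarrow> 'k)" where
  "coord_deriv i c = (\<lambda>r. of_int (r i) * c r)"

lemma coord_deriv_LP: "x \<in> LP N \<Longrightarrow> coord_deriv i x \<in> LP N"
  by (rule LP_I[of "{r. x r \<noteq> 0}"]) (auto simp: LP_def coord_deriv_def)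

lemma coord_deriv_leibniz:
  assumes "x \<in> LP (2*m)" "y \<in> LP (2*m)"
  shows "coord_deriv i (poisson m x y) = poisson m (coord_deriv i x) y + poisson m x (coord_deriv i y)"
proof
  fix t
  let ?A = "{r. x r \<noteq> 0}"
  have A: "finite ?A" using assms by (simp add: LP_finite)
  have 1: "poisson m (coord_deriv i x) y t = (if t = 0 then 0 else
      \<Sum>r\<in>?A. coord_deriv i x r * y (t - r) * of_int (omega m r (t - r)))"
    by (rule poisson_superset[OF A]) (auto simp: coord_deriv_def)
  show "coord_deriv i (poisson m x y) t = (poisson m (coord_deriv i x) y + poisson m x (coord_deriv i y)) t"
    by (simp add: plus_fun_apply 1)
      (simp add: poisson_def coord_deriv_def sum_distrib_left sum.distrib[symmetric]
        minus_apply algebra_simps)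
qed

lemma lp_linear_comp: "lp_linear N f \<Longrightarrow> lp_linear N g \<Longrightarrow> lp_linear N (\<lambda>x. f (g x))"
  unfolding lp_linear_def[of N "\<lambda>x. f (g x)"]
  by (auto simp: lp_linear_closed lp_linear_add lp_linear_scl)

lemma lp_linear_coord_deriv: "lp_linear N (coord_deriv i)"
  unfolding lp_linear_def
  by (auto simp: coord_deriv_LP)
    (auto simp: coord_deriv_def scl_def fun_eq_iff fun_apply algebra_simps)

lemma scl_hbasis_eq:
  assumes "scl a (hbasis p) = scl b (hbasis q)" "a \<noteq> 0"
  shows "p = q" "a = b"
  using fun_cong[OF assms(1), of p] assms(2)
  by (auto simp: scl_def hbasis_def split: if_splits)

lemma lie_auto_cancel:
  assumes "lie_auto m f"
  shows "x \<in> LP (2*m) \<Longrightarrow> f (inv_into (LP (2*m)) f x) = x"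
    and "x \<in> LP (2*m) \<Longrightarrow> inv_into (LP (2*m)) f (f x) = x"
  using lie_auto_bij[OF assms] by (auto simp: bij_betw_def f_inv_into_f inv_into_f_f)

text \<open>The conjugates \<open>f\<^sup>-\<^sup>1 d\<^sub>i f\<close> are locally finite derivations, hence diagonal. So \<open>f h\<^sub>r\<close> is a
  simultaneous eigenvector of all \<open>d\<^sub>i\<close>, whose joint eigenspaces are spanned by single basis vectors.\<close>

lemma lie_auto_monomial:
  fixes f :: "((nat \<Rightarrow> int) \<Rightarrow> 'k::field_char_0) \<Rightarrow> ((nat \<Rightarrow> int) \<Rightarrow> 'k)"
  assumes f: "lie_auto m f" and r: "r \<in> nzvecs (2*m)"
  obtains c p where "c \<noteq> 0" "p \<in> nzvecs (2*m)" "f (hbasis r) = scl c (hbasis p)"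
proof -
  let ?L = "LP (2*m) :: ((nat \<Rightarrow> int) \<Rightarrow> 'k) set"
  define g where "g = inv_into ?L f"
  have g: "lie_auto m g" unfolding g_def by (rule lie_auto_inv[OF f])
  note fg = lie_auto_cancel[OF f, folded g_def]
  note linf = lie_auto_linear[OF f] and ling = lie_auto_linear[OF g]
  note fL = lp_linear_closed[OF linf] and gL = lp_linear_closed[OF ling]
  define y where "y = f (hbasis r)"
  have y: "y \<in> ?L" using r by (simp add: y_def fL LP_hbasis)
  have eigen: "of_int (p i) * y p = of_int (q i) * y p" if p: "y p \<noteq> 0" and q: "y q \<noteq> 0" for i p q
  proof -
    define D where "D x = g (coord_deriv i (f x))" for x
    have lin: "lp_linear (2*m) D"
      unfolding D_def by (rule lp_linear_comp[OF ling lp_linear_comp[OF lp_linear_coord_deriv linf]])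
    interpret lp_derivation m D
    proof
      fix u v :: "(nat \<Rightarrow> int) \<Rightarrow> 'k" assume uv: "u \<in> ?L" "v \<in> ?L"
      have "D (poisson m u v) = g (poisson m (coord_deriv i (f u)) (f v)) +
          g (poisson m (f u) (coord_deriv i (f v)))"
        using uv by (simp add: D_def lie_auto_poisson[OF f] coord_deriv_leibniz fL
            lp_linear_add[OF ling] poisson_LP coord_deriv_LP)
      then show "D (poisson m u v) = poisson m (D u) v + poisson m u (D v)"
        using uv by (simp add: D_def lie_auto_poisson[OF g] fL coord_deriv_LP fg)
    qed (rule lin)
    \<comment> \<open>Inner factors \<open>f\<close> and \<open>g\<close> cancel in the powers of
      the conjugate, and powers of \<open>coord_deriv i\<close> merely rescale coefficients.\<close>
    have pow: "(D ^^ k) x = g (\<lambda>s. of_int (s i) ^ k * f x s)" if x: "x \<in> ?L" for k x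
    proof (induction k)
      case 0
      then show ?case using x by (simp add: fg)
    next
      case (Suc k)
      have "(\<lambda>s. of_int (s i) ^ k * f x s) \<in> ?L"
        by (rule LP_I[of "{s. f x s \<noteq> 0}"]) (use fL[OF x] in \<open>auto simp: LP_def\<close>)
      then have "(D ^^ Suc k) x = g (coord_deriv i (\<lambda>s. of_int (s i) ^ k * f x s))"
        by (simp add: Suc D_def fg)
      then show ?case by (simp add: coord_deriv_def algebra_simps)
    qed
    have "q' = r" if "D (hbasis r) q' \<noteq> 0" for q'
    proof (rule locally_finite_imp_diagonal[OF _ r that])
      fix s assume s: "s \<in> nzvecs (2*m)"
      define x where "x = f (hbasis s)"
      have x: "x \<in> ?L" using s by (simp add: x_def fL LP_hbasis)
      \<comment> \<open>Rescaling never enlarges the support of \<open>f (hbasis s)\<close>, so all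
        iterates stay in the supports of \<open>g (hbasis u)\<close> for \<open>u\<close> in that
        fixed finite set.\<close>
      let ?B = "\<Union>u\<in>{u. x u \<noteq> 0}. {v. g (hbasis u) v \<noteq> 0}"
      have "finite ?B"
        using LP_finite[OF x] LP_supp[OF x] by (auto intro!: LP_finite[OF gL] LP_hbasis)
      moreover have "v \<in> ?B" if v: "(D ^^ k) (hbasis s) v \<noteq> 0" for k v
      proof -
        let ?z = "\<lambda>u. of_int (u i) ^ k * x u"
        have "?z \<in> ?L"
          by (rule LP_I[of "{s. x s \<noteq> 0}"]) (use x in \<open>auto simp: LP_def\<close>)
        moreover have "g ?z v \<noteq> 0" using v s by (simp add: pow LP_hbasis x_def)
        ultimately have "(\<Sum>u | ?z u \<noteq> 0. ?z u * g (hbasis u) v) \<noteq> 0"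
          by (simp only: lp_linear_expand[OF ling] not_False_eq_True)
        then obtain u where "u \<in> {u. ?z u \<noteq> 0}" "?z u * g (hbasis u) v \<noteq> 0"
          by (rule sum.not_neutral_contains_not_neutral)
        then show ?thesis by auto
      qed
      ultimately show "\<exists>B. finite B \<and> (\<forall>k q. (D ^^ k) (hbasis s) q \<noteq> 0 \<longrightarrow> q \<in> B)" by blast
    qed
    then have "D (hbasis r) = scl (D (hbasis r) r) (hbasis r)"
      by (intro ext) (auto simp: scl_def hbasis_def)
    then obtain l where "D (hbasis r) = scl l (hbasis r)" by blast
    then have "f (D (hbasis r)) = scl l y" using r by (simp add: y_def lp_linear_scl[OF linf] LP_hbasis)
    then have "coord_deriv i y = scl l y"
      using r by (simp add: D_def fg coord_deriv_LP fL LP_hbasis y_def)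
    then have "of_int (u i) * y u = l * y u" for u by (metis coord_deriv_def scl_def)
    from this[of p] this[of q] p q show ?thesis by simp
  qed
  have "g y = hbasis r" using r by (simp add: y_def fg LP_hbasis)
  then have "g y r \<noteq> g 0 r" by (simp add: lp_linear_zero[OF ling] zero_fun_apply)
  then have "y \<noteq> 0" by auto
  then obtain p where p: "y p \<noteq> 0" by (auto simp: fun_eq_iff fun_apply)
  \<comment> \<open>All coordinates of \<open>p\<close> and \<open>q\<close> agree after the
    embedding of the integers into the field, which is injective in characteristic zero.\<close>
  have "q = p" if q: "y q \<noteq> 0" for q
    using eigen[OF p q] p by (auto simp: fun_eq_iff)
  then have "y = scl (y p) (hbasis p)" by (intro ext) (auto simp: scl_def hbasis_def)
  then show ?thesis using that p LP_supp[OF y p] unfolding y_def by blast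
qed

text \<open>For nonzero \<open>a\<close> the support of the first argument, over which the sum runs,
  does not change.\<close>

lemma poisson_scl:
  assumes "a \<noteq> 0"
  shows "poisson m (scl a x) (scl b y) = scl (a * b) (poisson m x y)"
  using assms by (auto simp: poisson_def scl_def fun_eq_iff sum_distrib_left algebra_simps)

text \<open>All relations come from applying \<open>f\<close> to \<open>[h_r, h_s]\<close>. If the
  form is nonzero, comparing lines and scalars gives additivity and the relation for
  \<open>b\<close>; if it is zero, the image bracket must vanish, so orthogonality is preserved.
  Additivity for orthogonal pairs is then supplied by
  \<open>quasi_additive_imp_additive\<close>.\<close>

lemma lie_auto_support_map:
  fixes f :: "((nat \<Rightarrow> int) \<Rightarrow> 'k::field_char_0) \<Rightarrow> ((nat \<Rightarrow> int) \<Rightarrow> 'k)"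
  assumes f: "lie_auto m f"
  obtains b P where
    "P 0 = 0" "\<And>r. P r \<in> zvecs (2*m)"
    "\<And>r. r \<in> nzvecs (2*m) \<Longrightarrow> b r \<noteq> 0"
    "\<And>r. r \<in> nzvecs (2*m) \<Longrightarrow> P r \<in> nzvecs (2*m)"
    "\<And>r. r \<in> nzvecs (2*m) \<Longrightarrow> f (hbasis r) = scl (b r) (hbasis (P r))"
    "\<And>r s. r \<in> zvecs (2*m) \<Longrightarrow> s \<in> zvecs (2*m) \<Longrightarrow> P (r + s) = P r + P s"
    "\<And>r s. r \<in> zvecs (2*m) \<Longrightarrow> s \<in> zvecs (2*m) \<Longrightarrow> omega m r s \<noteq> 0 \<Longrightarrow>
       of_int (omega m r s) * b (r + s) = b r * b s * of_int (omega m (P r) (P s))"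
    "\<And>r s. r \<in> zvecs (2*m) \<Longrightarrow> s \<in> zvecs (2*m) \<Longrightarrow> omega m r s = 0 \<Longrightarrow> omega m (P r) (P s) = 0"
proof -
  have "\<exists>c p. r \<in> nzvecs (2*m) \<longrightarrow> c \<noteq> 0 \<and> p \<in> nzvecs (2*m) \<and> f (hbasis r) = scl c (hbasis p)" for r
    using lie_auto_monomial[OF f] by metis
  then obtain b p where bp: "\<And>r. r \<in> nzvecs (2*m) \<Longrightarrow>
      b r \<noteq> 0 \<and> p r \<in> nzvecs (2*m) \<and> f (hbasis r) = scl (b r) (hbasis (p r))"
    by metis
  \<comment> \<open>Since \<open>h_0 = 0\<close>, the automorphism says nothing about index zero;
    the value there is set as additivity requires.\<close>
  define P where "P r = (if r \<in> nzvecs (2*m) then p r else 0)" for r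
  have P0: "P 0 = 0" by (simp add: P_def)
  have Pz: "P r \<in> zvecs (2*m)" for r using bp by (auto simp: P_def)
  have fP: "b r \<noteq> 0" "P r \<in> nzvecs (2*m)" "f (hbasis r) = scl (b r) (hbasis (P r))"
    if "r \<in> nzvecs (2*m)" for r
    using bp that by (auto simp: P_def)
  have rel: "f (scl (of_int (omega m r s)) (hbasis (r + s))) =
      scl (b r * b s * of_int (omega m (P r) (P s))) (hbasis (P r + P s))"
    if "r \<in> nzvecs (2*m)" "s \<in> nzvecs (2*m)" for r s
  proof -
    have "f (scl (of_int (omega m r s)) (hbasis (r + s))) = poisson m (f (hbasis r)) (f (hbasis s))"
      using that by (simp only: lie_auto_poisson[OF f] LP_hbasis poisson_hbasis_hbasis[symmetric])
    then show ?thesis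
      using that by (simp add: fP poisson_scl poisson_hbasis_hbasis scl_scl)
  qed
  have om: "P (r + s) = P r + P s \<and>
       of_int (omega m r s) * b (r + s) = b r * b s * of_int (omega m (P r) (P s))"
    if "r \<in> zvecs (2*m)" "s \<in> zvecs (2*m)" and ne: "omega m r s \<noteq> 0" for r s
  proof -
    have "r \<noteq> 0" "s \<noteq> 0" "r + s \<noteq> 0"
      using ne by (auto simp: add_eq_0_iff omega_minus_left omega_minus_right)
    then have rs: "r \<in> nzvecs (2*m)" "s \<in> nzvecs (2*m)" "r + s \<in> nzvecs (2*m)"
      using that by (auto intro: zvecs_add)
    have "scl (of_int (omega m r s) * b (r + s)) (hbasis (P (r + s))) =
        scl (b r * b s * of_int (omega m (P r) (P s))) (hbasis (P r + P s))"
      using rel[OF rs(1,2)] rs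
      by (simp add: lp_linear_scl[OF lie_auto_linear[OF f]] LP_hbasis fP scl_scl)
    from scl_hbasis_eq[OF this] show ?thesis using ne fP[OF rs(3)] by simp
  qed
  have om0: "omega m (P r) (P s) = 0"
    if "r \<in> zvecs (2*m)" "s \<in> zvecs (2*m)" and eq: "omega m r s = 0" for r s
  proof (cases "r = 0 \<or> s = 0")
    case True
    then show ?thesis by (auto simp: P0)
  next
    case False
    then have rs: "r \<in> nzvecs (2*m)" "s \<in> nzvecs (2*m)" using that by auto
    have "0 = scl (b r * b s * of_int (omega m (P r) (P s))) (hbasis (P r + P s))"
      using rel[OF rs] by (simp add: eq scl_zero lp_linear_zero[OF lie_auto_linear[OF f]])
    from fun_cong[OF this, of "P r + P s"] show ?thesis
      using fP rs by (simp add: scl_def zero_fun_apply)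
  qed
  have add: "P (r + s) = P r + P s" if "r \<in> zvecs (2*m)" "s \<in> zvecs (2*m)" for r s
    by (rule quasi_additive_imp_additive[where op = "(+)" and m = m])
      (use that om P0 in \<open>auto simp: add.assoc\<close>)
  show ?thesis
    by (rule that[of P b]) (use P0 Pz fP add om om0 in auto)
qed

text \<open>In terms of the basis, \<open>h\<^sub>r\<close> with \<open>r = Q\<^sup>T s\<close> goes to \<open>gsign Q\<close> times \<open>a\<^sup>s h\<^sub>s\<close>. The sign is forced, since
  the bracket is quadratic in the scalars while the symplectic form changes by that sign.\<close>

definition actL :: "nat \<Rightarrow> (nat \<Rightarrow> nat \<Rightarrow> int) \<Rightarrow> (nat \<Rightarrow> 'k::field) \<Rightarrow> ((nat \<Rightarrow> int) \<Rightarrow> 'k) \<Rightarrow> (nat \<Rightarrow> int) \<Rightarrow> 'k" where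
  "actL m Q a c = (\<lambda>t. if t \<in> zvecs (2*m)
     then of_int (gsign m Q) * chr (2*m) a t * c (tv (2*m) Q t) else 0)"

lemma of_int_gsign_square [simp]: "of_int (gsign m Q) * (of_int (gsign m Q) :: 'k::field) = 1"
  by (simp add: gsign_def)

lemma of_int_gsign_nonzero [simp]: "of_int (gsign m Q) \<noteq> (0 :: 'k::field)"
  by (simp add: gsign_def)

lemma tv_inverse:
  assumes "mat_mul N Q Q' = mat_id N" "r \<in> zvecs N"
  shows "tv N Q' (tv N Q r) = r"
  using assms by (simp add: tv_mul[symmetric] tv_id)

lemma tv_nonzero:
  assumes "Q \<in> GSp_Z m" "r \<in> nzvecs (2*m)"
  shows "tv (2*m) Q r \<in> nzvecs (2*m)"
proof -
  obtain Q' where "mat_mul (2*m) Q Q' = mat_id (2*m)"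
    using assms(1) by (rule GSp_Z_obtain_inverse)
  then have "tv (2*m) Q' (tv (2*m) Q r) = r" using assms by (intro tv_inverse) auto
  then show ?thesis using assms by (auto simp: tv_zvecs GSp_Z_intmats)
qed

lemma actL_LP:
  assumes Q: "Q \<in> GSp_Z m" and c: "c \<in> LP (2*m)"
  shows "actL m Q a c \<in> LP (2*m)"
proof -
  obtain Q' where Q': "Q' \<in> GSp_Z m" "mat_mul (2*m) Q Q' = mat_id (2*m)"
    using Q by (rule GSp_Z_obtain_inverse)
  show ?thesis
  proof (rule LP_I)
    show "finite (tv (2*m) Q' ` {r. c r \<noteq> 0})" using LP_finite[OF c] by simp
    show "tv (2*m) Q' ` {r. c r \<noteq> 0} \<subseteq> nzvecs (2*m)"
    proof (rule image_subsetI)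
      fix r assume "r \<in> {r. c r \<noteq> 0}"
      then have "c r \<noteq> 0" by simp
      from LP_supp[OF c this] show "tv (2*m) Q' r \<in> nzvecs (2*m)" by (rule tv_nonzero[OF Q'(1)])
    qed
    fix t assume "actL m Q a c t \<noteq> 0"
    then have "t \<in> zvecs (2*m)" "c (tv (2*m) Q t) \<noteq> 0" by (auto simp: actL_def split: if_splits)
    then show "t \<in> tv (2*m) Q' ` {r. c r \<noteq> 0}"
      using tv_inverse[OF Q'(2)] by (metis (mono_tags, lifting) imageI mem_Collect_eq)
  qed
qed

lemma actL_linear: "Q \<in> GSp_Z m \<Longrightarrow> lp_linear (2*m) (actL m Q a)"
  unfolding lp_linear_def
  by (auto simp: actL_LP) (rule ext, simp add: actL_def scl_def plus_fun_apply algebra_simps)+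

text \<open>Coefficients are read at \<open>Q^T t\<close>, and this pullback cancels the order
  reversal of the transpose. The inner torus point picks up \<open>Q1\<close> because its character
  is evaluated at \<open>Q1^T t\<close>.\<close>

lemma actL_mul:
  fixes a1 a2 :: "nat \<Rightarrow> 'k::field"
  assumes "m \<ge> 1" "Q1 \<in> GSp_Z m" "Q2 \<in> GSp_Z m" "a2 \<in> torus (2*m)"
  shows "actL m Q1 a1 (actL m Q2 a2 c) =
    actL m (mat_mul (2*m) Q1 Q2) (\<lambda>j. a1 j * torus_act (2*m) Q1 a2 j) c"
  using assms by (auto simp: actL_def fun_eq_iff tv_zvecs GSp_Z_intmats tv_mul GSp_Z_mul chr_mult
      chr_torus_act mult_ac[where 'a='k])

lemma actL_id: "c \<in> LP (2*m) \<Longrightarrow> actL m (mat_id (2*m)) (\<lambda>_. 1) c = c"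
  using LP_supp[of c "2*m"] by (auto simp: actL_def fun_eq_iff gsign_id tv_id)

text \<open>After reindexing the sum by the inverse matrix three signs meet, two from the factors
  and one from the form. Their product is the single sign carried by \<open>actL\<close>.\<close>

lemma actL_poisson:
  fixes a :: "nat \<Rightarrow> 'k::field"
  assumes Q: "Q \<in> GSp_Z m" and a: "a \<in> torus (2*m)" and x: "x \<in> LP (2*m)" and y: "y \<in> LP (2*m)"
  shows "actL m Q a (poisson m x y) = poisson m (actL m Q a x) (actL m Q a y)"
proof
  fix t
  obtain Q' where Q': "Q' \<in> GSp_Z m" "mat_mul (2*m) Q Q' = mat_id (2*m)" "mat_mul (2*m) Q' Q = mat_id (2*m)"
    using Q by (rule GSp_Z_obtain_inverse)
  let ?A = "{r. x r \<noteq> 0}" and ?e = "of_int (gsign m Q) :: 'k"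
  have A: "finite ?A" "?A \<subseteq> nzvecs (2*m)" using LP_finite[OF x] LP_supp[OF x] by auto
  have inv: "tv (2*m) Q (tv (2*m) Q' r) = r" if "r \<in> ?A" for r
    using tv_inverse[OF Q'(3)] A that by blast
  show "actL m Q a (poisson m x y) t = poisson m (actL m Q a x) (actL m Q a y) t"
  proof (cases "t \<in> nzvecs (2*m)")
    case False
    then show ?thesis
      using LP_supp[OF actL_LP[OF Q poisson_LP[OF x y]]] LP_supp[OF poisson_LP[OF actL_LP[OF Q x] actL_LP[OF Q y]]]
      by metis
  next
    case t: True
    have "poisson m (actL m Q a x) (actL m Q a y) t = (\<Sum>r\<in>tv (2*m) Q' ` ?A.
        actL m Q a x r * actL m Q a y (t - r) * of_int (omega m r (t - r)))"
    proof (subst poisson_superset[of "tv (2*m) Q' ` ?A"])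
      fix r assume "actL m Q a x r \<noteq> 0"
      then have "r \<in> zvecs (2*m)" "x (tv (2*m) Q r) \<noteq> 0" by (auto simp: actL_def split: if_splits)
      then show "r \<in> tv (2*m) Q' ` ?A"
        using tv_inverse[OF Q'(2)] by (metis (mono_tags, lifting) imageI mem_Collect_eq)
    qed (use A t in auto)
    also have "\<dots> = (\<Sum>r\<in>?A. actL m Q a x (tv (2*m) Q' r) * actL m Q a y (t - tv (2*m) Q' r) *
        of_int (omega m (tv (2*m) Q' r) (t - tv (2*m) Q' r)))"
      by (subst sum.reindex) (use inv in \<open>auto intro: inj_on_inverseI\<close>)
    also have "\<dots> = (\<Sum>r\<in>?A. ?e * chr (2*m) a t * (x r * y (tv (2*m) Q t - r) *
        of_int (omega m r (tv (2*m) Q t - r))))"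
    proof (rule sum.cong[OF refl])
      fix r assume r: "r \<in> ?A"
      let ?r = "tv (2*m) Q' r"
      have z: "?r \<in> zvecs (2*m)" "t - ?r \<in> zvecs (2*m)"
        using t Q' by (auto intro!: zvecs_diff simp: tv_zvecs GSp_Z_intmats)
      have "omega m r (tv (2*m) Q t - r) = gsign m Q * omega m ?r (t - ?r)"
        using GSp_Z_omega[OF Q z] by (simp add: tv_diff inv[OF r])
      then have om: "(of_int (omega m ?r (t - ?r)) :: 'k) = ?e * of_int (omega m r (tv (2*m) Q t - r))"
        by (simp add: mult.assoc[symmetric])
      have "?r + (t - ?r) = t" by simp
      then have "chr (2*m) a t = chr (2*m) a ?r * chr (2*m) a (t - ?r)"
        using chr_add[OF a, of ?r "t - ?r"] by metis
      then have "actL m Q a x ?r * actL m Q a y (t - ?r) =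
          (?e * ?e) * chr (2*m) a t * (x r * y (tv (2*m) Q t - r))"
        using z inv[OF r] by (simp add: actL_def tv_diff mult_ac[where 'a='k])
      then show "actL m Q a x ?r * actL m Q a y (t - ?r) * of_int (omega m ?r (t - ?r)) =
          ?e * chr (2*m) a t * (x r * y (tv (2*m) Q t - r) * of_int (omega m r (tv (2*m) Q t - r)))"
        by (simp add: om mult_ac[where 'a='k])
    qed
    also have "\<dots> = actL m Q a (poisson m x y) t"
      using t tv_nonzero[OF Q t] by (simp add: actL_def poisson_def sum_distrib_left)
    finally show ?thesis ..
  qed
qed

text \<open>Preservation of orthogonality makes all mixed values on unit vectors vanish, so only the
  factors on the \<open>m\<close> hyperbolic pairs remain. A suitable orthogonal combination of two
  pairs forces these factors to agree.\<close>

lemma conformal_factor: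
  fixes P :: "(nat \<Rightarrow> int) \<Rightarrow> (nat \<Rightarrow> int)"
  assumes m: "m \<ge> 1"
    and add: "\<And>r s. r \<in> zvecs (2*m) \<Longrightarrow> s \<in> zvecs (2*m) \<Longrightarrow> P (r + s) = P r + P s"
    and ker: "\<And>r s. r \<in> zvecs (2*m) \<Longrightarrow> s \<in> zvecs (2*m) \<Longrightarrow> omega m r s = 0 \<Longrightarrow> omega m (P r) (P s) = 0"
  obtains e where "\<And>r s. r \<in> zvecs (2*m) \<Longrightarrow> s \<in> zvecs (2*m) \<Longrightarrow> omega m (P r) (P s) = e * omega m r s"
proof -
  define \<beta> where "\<beta> i = omega m (P (unit_vec (i + m))) (P (unit_vec i))" for i
  note unit = unit_vec_zvecs[of _ "2*m"]
  have P_neg: "P (- r) = - P r" if "r \<in> zvecs (2*m)" for r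
  proof -
    have "P 0 = 0" using add[of 0 0] by simp
    then show ?thesis using add[of r "- r"] that by (simp add: zvecs_minus add_eq_0_iff)
  qed
  have P_diff: "P (r - s) = P r - P s" if "r \<in> zvecs (2*m)" "s \<in> zvecs (2*m)" for r s
    using add[of r "- s"] that by (simp add: zvecs_minus P_neg)
  have const: "\<beta> i = \<beta> 0" if i: "i < m" for i
  proof (cases "i = 0")
    case False
    have z: "unit_vec (i + m) \<in> zvecs (2*m)" "unit_vec m \<in> zvecs (2*m)"
      "unit_vec i \<in> zvecs (2*m)" "unit_vec 0 \<in> zvecs (2*m)"
      using i m by (auto intro!: unit)
    \<comment> \<open>The contributions of the two pairs are \<open>1\<close> and \<open>-1\<close>.
      Expanding the form of the images leaves exactly \<open>\<beta> i - \<beta> 0\<close>.\<close>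
    have "omega m (unit_vec (i + m) + unit_vec m) (unit_vec i - unit_vec 0) = 0"
      using i m False by (simp add: omega_diff_right omega_unit_right omega_add_left plus_fun_apply)
        (simp add: unit_vec_def)
    then have "omega m (P (unit_vec (i + m)) + P (unit_vec m)) (P (unit_vec i) - P (unit_vec 0)) = 0"
      using ker[of "unit_vec (i + m) + unit_vec m" "unit_vec i - unit_vec 0"] z
      by (simp add: add P_diff zvecs_add zvecs_diff)
    moreover have "omega m (P (unit_vec (i + m))) (P (unit_vec 0)) = 0"
      using omega_unit_right(1)[of 0 m "unit_vec (i + m)"] z m False
      by (intro ker) (simp_all add: unit_vec_def)
    moreover have "omega m (P (unit_vec m)) (P (unit_vec i)) = 0"
      using omega_unit_right(1)[of i m "unit_vec m"] z i False
      by (intro ker) (simp_all add: unit_vec_def)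
    ultimately show ?thesis by (simp add: \<beta>_def omega_add_left omega_diff_right)
  qed auto
  have lower: "omega m (P (unit_vec i)) (P (unit_vec j)) = \<beta> 0 * omega m (unit_vec i) (unit_vec j)"
    if ij: "i < 2*m" "j < m" for i j
  proof (cases "i = j + m")
    case True
    then have "omega m (unit_vec i) (unit_vec j) = 1"
      using omega_unit_right(1)[OF ij(2), of "unit_vec i"] by (simp add: unit_vec_def)
    then show ?thesis using const[OF ij(2)] by (simp add: \<beta>_def True)
  next
    case False
    then have "omega m (unit_vec i) (unit_vec j) = 0"
      using omega_unit_right(1)[OF ij(2), of "unit_vec i"] by (simp add: unit_vec_def)
    then show ?thesis using ij by (simp add: ker unit)
  qed
  have basis: "omega m (P (unit_vec i)) (P (unit_vec j)) = \<beta> 0 * omega m (unit_vec i) (unit_vec j)"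
    if ij: "i < 2*m" "j < 2*m" for i j
  proof (cases "j < m")
    case True
    then show ?thesis using lower ij by blast
  next
    case j: False
    show ?thesis
    proof (cases "i < m")
      case True
      then show ?thesis using lower[of j i] ij omega_skew[of m _ "unit_vec j"] omega_skew[of m _ "P (unit_vec j)"]
        by simp
    next
      case False
      then have "omega m (unit_vec i) (unit_vec j) = 0"
        using ij j omega_unit_right(2)[of "j - m" m "unit_vec i"] by (simp add: unit_vec_def)
      then show ?thesis using ij by (simp add: ker unit)
    qed
  qed
  show ?thesis
  proof (rule that)
    fix r s assume rs: "r \<in> zvecs (2*m)" "s \<in> zvecs (2*m)"
    show "omega m (P r) (P s) = \<beta> 0 * omega m r s"
      by (rule biadditive_eqI[of "2*m" "\<lambda>r s. omega m (P r) (P s)" "\<lambda>r s. \<beta> 0 * omega m r s",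
            OF _ _ _ _ basis rs])
        (simp_all add: add omega_add_left omega_add_right distrib_left)
  qed
qed

text \<open>The images of the unit vectors are the rows, not the columns, since \<open>tv\<close>
  applies the transpose.\<close>

lemma additive_matrix:
  fixes P :: "(nat \<Rightarrow> int) \<Rightarrow> (nat \<Rightarrow> int)"
  assumes add: "\<And>r s. r \<in> zvecs N \<Longrightarrow> s \<in> zvecs N \<Longrightarrow> P (r + s) = P r + P s"
    and P: "\<And>r. P r \<in> zvecs N"
  obtains Q where "Q \<in> intmats N" "\<And>r. r \<in> zvecs N \<Longrightarrow> tv N Q r = P r"
proof
  let ?Q = "\<lambda>i j. if i < N then P (unit_vec i) j else 0"
  show "?Q \<in> intmats N" using P by (auto simp: intmats_def zvecs_def)
  fix r assume r: "r \<in> zvecs N"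
  show "tv N ?Q r = P r"
  proof
    fix j
    have "P r j = (\<Sum>i<N. r i * P (unit_vec i) j)"
      by (rule additive_expand[of N "\<lambda>r. P r j", OF _ r]) (simp add: add plus_fun_apply)
    then show "tv N ?Q r j = P r j" by (simp add: tv_def mult.commute)
  qed
qed

lemma mat_mul_eq_idI:
  assumes "A \<in> intmats N" "B \<in> intmats N" "\<And>r. r \<in> zvecs N \<Longrightarrow> tv N B (tv N A r) = r"
  shows "mat_mul N A B = mat_id N"
proof (rule intmats_eqI[of _ N])
  fix i assume i: "i < N"
  then have "tv N (mat_mul N A B) (unit_vec i) = tv N (mat_id N) (unit_vec i)"
    using assms(3) by (simp only: tv_mul tv_id unit_vec_zvecs)
  then show "mat_mul N A B i = mat_id N i" using i by (simp only: tv_unit)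
qed (use assms in \<open>auto simp: mat_mul_intmats mat_id_intmats\<close>)

text \<open>\<open>Q\<close> encodes the index permutation \<open>P\<close> of the inverse
  \<open>f\<close>, because \<open>actL\<close> pulls coefficients back. The permutation
  \<open>P'\<close> of \<open>\<sigma>\<close> itself serves to invert \<open>P\<close> and so
  places \<open>Q\<close> in \<open>GL_Z\<close>.\<close>

theorem lie_auto_classification:
  fixes \<sigma> :: "((nat \<Rightarrow> int) \<Rightarrow> 'k::field_char_0) \<Rightarrow> ((nat \<Rightarrow> int) \<Rightarrow> 'k)"
  assumes m: "m \<ge> 1" and \<sigma>: "lie_auto m \<sigma>"
  obtains Q a where "Q \<in> GSp_Z m" "a \<in> torus (2*m)" "\<And>c. c \<in> LP (2*m) \<Longrightarrow> \<sigma> c = actL m Q a c"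
proof -
  let ?L = "LP (2*m) :: ((nat \<Rightarrow> int) \<Rightarrow> 'k) set" and ?Z = "zvecs (2*m)"
  define f where "f = inv_into ?L \<sigma>"
  have f: "lie_auto m f" unfolding f_def by (rule lie_auto_inv[OF \<sigma>])
  note \<sigma>f = lie_auto_cancel[OF \<sigma>, folded f_def]
  note lin\<sigma> = lie_auto_linear[OF \<sigma>] and linf = lie_auto_linear[OF f]
  obtain b P where P0: "P 0 = 0" and Pz: "\<And>r. P r \<in> ?Z"
    and b: "\<And>r. r \<in> nzvecs (2*m) \<Longrightarrow> b r \<noteq> 0"
    and Pnz: "\<And>r. r \<in> nzvecs (2*m) \<Longrightarrow> P r \<in> nzvecs (2*m)"
    and fP: "\<And>r. r \<in> nzvecs (2*m) \<Longrightarrow> f (hbasis r) = scl (b r) (hbasis (P r))"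
    and Padd: "\<And>r s. r \<in> ?Z \<Longrightarrow> s \<in> ?Z \<Longrightarrow> P (r + s) = P r + P s"
    and bP: "\<And>r s. r \<in> ?Z \<Longrightarrow> s \<in> ?Z \<Longrightarrow> omega m r s \<noteq> 0 \<Longrightarrow>
       of_int (omega m r s) * b (r + s) = b r * b s * of_int (omega m (P r) (P s))"
    and ker: "\<And>r s. r \<in> ?Z \<Longrightarrow> s \<in> ?Z \<Longrightarrow> omega m r s = 0 \<Longrightarrow> omega m (P r) (P s) = 0"
    by (rule lie_auto_support_map[OF f]) (rule that, assumption+)
  obtain b' P' where P'0: "P' 0 = 0" and P'z: "\<And>r. P' r \<in> ?Z"
    and b': "\<And>r. r \<in> nzvecs (2*m) \<Longrightarrow> b' r \<noteq> 0"
    and P'nz: "\<And>r. r \<in> nzvecs (2*m) \<Longrightarrow> P' r \<in> nzvecs (2*m)"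
    and \<sigma>P': "\<And>r. r \<in> nzvecs (2*m) \<Longrightarrow> \<sigma> (hbasis r) = scl (b' r) (hbasis (P' r))"
    and P'add: "\<And>r s. r \<in> ?Z \<Longrightarrow> s \<in> ?Z \<Longrightarrow> P' (r + s) = P' r + P' s"
    and _: "\<And>r s. r \<in> ?Z \<Longrightarrow> s \<in> ?Z \<Longrightarrow> omega m r s \<noteq> 0 \<Longrightarrow>
       of_int (omega m r s) * b' (r + s) = b' r * b' s * of_int (omega m (P' r) (P' s))"
    and _: "\<And>r s. r \<in> ?Z \<Longrightarrow> s \<in> ?Z \<Longrightarrow> omega m r s = 0 \<Longrightarrow> omega m (P' r) (P' s) = 0"
    by (rule lie_auto_support_map[OF \<sigma>]) (rule that, assumption+)
  have P'P: "P' (P r) = r" if r: "r \<in> ?Z" for r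
  proof (cases "r = 0")
    case False
    then have rn: "r \<in> nzvecs (2*m)" using r by simp
    have "\<sigma> (f (hbasis r)) = hbasis r" using rn by (simp add: \<sigma>f LP_hbasis)
    then have "scl (b r * b' (P r)) (hbasis (P' (P r))) = (scl 1 (hbasis r) :: _ \<Rightarrow> 'k)"
      using rn Pnz[OF rn] by (simp add: fP lp_linear_scl[OF lin\<sigma>] LP_hbasis \<sigma>P' scl_scl)
    then show ?thesis by (rule scl_hbasis_eq) (use rn b b' Pnz in auto)
  qed (simp add: P0 P'0)
  have PP': "P (P' r) = r" if r: "r \<in> ?Z" for r
  proof (cases "r = 0")
    case False
    then have rn: "r \<in> nzvecs (2*m)" using r by simp
    have "f (\<sigma> (hbasis r)) = hbasis r" using rn by (simp add: \<sigma>f LP_hbasis)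
    then have "scl (b' r * b (P' r)) (hbasis (P (P' r))) = (scl 1 (hbasis r) :: _ \<Rightarrow> 'k)"
      using rn P'nz[OF rn] by (simp add: fP lp_linear_scl[OF linf] LP_hbasis \<sigma>P' scl_scl)
    then show ?thesis by (rule scl_hbasis_eq) (use rn b b' P'nz in auto)
  qed (simp add: P0 P'0)
  obtain Q where Q: "Q \<in> intmats (2*m)" "\<And>r. r \<in> ?Z \<Longrightarrow> tv (2*m) Q r = P r"
    using additive_matrix[of "2*m" P] Padd Pz by metis
  obtain Q' where Q': "Q' \<in> intmats (2*m)" "\<And>r. r \<in> ?Z \<Longrightarrow> tv (2*m) Q' r = P' r"
    using additive_matrix[of "2*m" P'] P'add P'z by metis
  have "mat_mul (2*m) Q Q' = mat_id (2*m)" "mat_mul (2*m) Q' Q = mat_id (2*m)"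
    by (rule mat_mul_eq_idI; simp add: Q Q' Pz P'z P'P PP')+
  then have QGL: "Q \<in> GL_Z (2*m)" unfolding GL_Z_def using Q(1) Q'(1) by blast
  obtain e where e: "\<And>r s. r \<in> ?Z \<Longrightarrow> s \<in> ?Z \<Longrightarrow> omega m (P r) (P s) = e * omega m r s"
    using conformal_factor[OF m, of P] Padd ker by metis
  \<comment> \<open>Since \<open>P\<close> is onto the lattice, a pair of form 1 consists of images,
    which shows that \<open>e\<close> is a unit of the integers.\<close>
  have "1 = omega m (P (P' (unit_vec m))) (P (P' (unit_vec 0)))"
    using m by (simp add: PP' unit_vec_zvecs omega_unit_one)
  also have "\<dots> = e * omega m (P' (unit_vec m)) (P' (unit_vec 0))" by (rule e[OF P'z P'z])
  finally have "e dvd 1" by (metis dvdI)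
  then have e1: "e = 1 \<or> e = -1" by (auto simp: zdvd1_eq)
  have QGSp: "Q \<in> GSp_Z m" by (rule GSp_Z_I[OF QGL e1]) (simp add: Q e)
  have eQ: "gsign m Q = e" by (rule gsign_eqI[OF m QGSp]) (simp add: Q e)
  \<comment> \<open>The factor \<open>of_int e\<close> absorbs the sign in
    \<open>b (r + s) = e b r b s\<close>, as \<open>e\<close> squares to 1; the value at zero is
    that of a character.\<close>
  define \<chi> where "\<chi> r = (if r = 0 then 1 else of_int e * b r)" for r
  have ee: "of_int e * (of_int e :: 'k) = 1" using e1 by auto
  have \<chi>nz: "\<chi> r \<noteq> 0" if "r \<in> ?Z" for r using b that e1 by (auto simp: \<chi>_def)
  have \<chi>gen: "\<chi> (r + s) = \<chi> r * \<chi> s" if rs: "r \<in> ?Z" "s \<in> ?Z" and ne: "omega m r s \<noteq> 0" for r s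
  proof -
    have nz: "r \<noteq> 0" "s \<noteq> 0" "r + s \<noteq> 0"
      using ne by (auto simp: add_eq_0_iff omega_minus_left omega_minus_right)
    have "of_int (omega m r s) * b (r + s) = of_int (omega m r s) * (of_int e * b r * b s)"
      using bP[OF rs ne] e[OF rs] by (simp add: algebra_simps)
    then have "b (r + s) = of_int e * b r * b s" using ne by simp
    then show ?thesis using nz ee by (simp add: \<chi>_def algebra_simps)
  qed
  have \<chi>mult: "\<chi> (r + s) = \<chi> r * \<chi> s" if rs: "r \<in> ?Z" "s \<in> ?Z" for r s
  proof (rule quasi_additive_imp_additive[where op = "(*)" and m = m])
    show "\<chi> 0 * x = x" "x * \<chi> 0 = x" for x by (simp_all add: \<chi>_def)
    show "x = y" if "z \<in> ?Z" "x * \<chi> z = y * \<chi> z" for x y z using that \<chi>nz by simp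
  qed (use rs \<chi>gen in auto)
  \<comment> \<open>The inverse appears because \<open>b\<close> and \<open>\<chi>\<close> belong to
    \<open>f\<close>, while \<open>a\<close> has to describe \<open>\<sigma>\<close>.\<close>
  define a where "a i = (if i < 2*m then inverse (\<chi> (unit_vec i)) else 1)" for i
  have a: "a \<in> torus (2*m)" by (auto simp: torus_def a_def \<chi>nz unit_vec_zvecs)
  have chr_a: "chr (2*m) a t = inverse (\<chi> t)" if t: "t \<in> ?Z" for t
  proof -
    have "\<chi> t = chr (2*m) (\<lambda>i. \<chi> (unit_vec i)) t"
      by (rule multiplicative_expand[OF \<chi>mult \<chi>nz t])
    then show ?thesis by (simp add: chr_def a_def power_int_inverse prod_inversef[unfolded o_def])
  qed
  have "\<sigma> (hbasis r) = actL m Q a (hbasis r)" if r: "r \<in> nzvecs (2*m)" for r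
  proof -
    define t where "t = P' r"
    have t: "t \<in> nzvecs (2*m)" "P t = r" using P'nz[OF r] PP'[of r] r by (simp_all add: t_def)
    have "hbasis t = \<sigma> (f (hbasis t))" using t by (simp add: \<sigma>f LP_hbasis)
    also have "\<dots> = scl (b t) (\<sigma> (hbasis r))"
      using t r by (simp add: fP lp_linear_scl[OF lin\<sigma>] LP_hbasis)
    finally have "scl (inverse (b t)) (hbasis t) = scl (inverse (b t) * b t) (\<sigma> (hbasis r))"
      by (simp only: scl_scl)
    then have 1: "\<sigma> (hbasis r) = scl (inverse (b t)) (hbasis t)" using b[OF t(1)] by simp
    have inj: "P u = r \<longleftrightarrow> u = t" if "u \<in> ?Z" for u
    proof
      assume "P u = r"
      then have "P' (P u) = P' (P t)" using t(2) by simp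
      then show "u = t" using P'P[OF that] P'P[of t] t(1) by simp
    qed (simp add: t(2))
    have "inverse (b t) = of_int e * inverse (\<chi> t)"
      using t(1) e1 by (auto simp: \<chi>_def)
    then have "actL m Q a (hbasis r) = scl (inverse (b t)) (hbasis t)"
      using t(1) by (intro ext) (auto simp: actL_def scl_def hbasis_def eQ Q(2) inj chr_a)
    with 1 show ?thesis by simp
  qed
  then have "\<sigma> c = actL m Q a c" if "c \<in> ?L" for c
    using lp_linear_eqI[OF lin\<sigma> actL_linear[OF QGSp] that] by blast
  then show ?thesis using that QGSp a by blast
qed

section \<open>The full algebra and the automorphism groups\<close>

text \<open>\<open>Q\<close> itself acts on the torus part while \<open>Q^T\<close> acts on indices;
  this is dictated by \<open>(Q u, t) = (u, Q^T t)\<close>.\<close>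

definition actU :: "nat \<Rightarrow> (nat \<Rightarrow> nat \<Rightarrow> int) \<Rightarrow> (nat \<Rightarrow> 'k::field) \<Rightarrow> nat \<Rightarrow> 'k" where
  "actU N Q u = (\<lambda>i. \<Sum>j<N. of_int (Q i j) * u j)"

definition act :: "nat \<Rightarrow> (nat \<Rightarrow> nat \<Rightarrow> int) \<times> (nat \<Rightarrow> 'k::field) \<Rightarrow> 'k ham \<Rightarrow> 'k ham" where
  "act m p x = (actL m (fst p) (snd p) (fst x), actU (2*m) (fst p) (snd x))"

lemma act_pair: "act m (Q, a) (c, u) = (actL m Q a c, actU (2*m) Q u)"
  by (simp add: act_def)

lemma ham_carrier_iff: "(c, u) \<in> ham_carrier N \<longleftrightarrow> c \<in> LP N \<and> (\<forall>i\<ge>N. u i = 0)"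
  by (auto simp: ham_carrier_def LP_def zero_fun_def)

lemma ham_derived_carrier_iff: "(c, u) \<in> ham_derived_carrier N \<longleftrightarrow> c \<in> LP N \<and> u = 0"
  by (auto simp: ham_derived_carrier_def ham_carrier_iff zero_fun_def)

lemma ham_derived_subset: "ham_derived_carrier N \<subseteq> ham_carrier N"
  by (auto simp: ham_derived_carrier_def)

lemma ham_add_pair: "ham_add (c, u) (d, v) = (c + d, u + v)"
  by (simp add: ham_add_def plus_fun_def)

lemma ham_scale_pair: "ham_scale a (c, u) = (scl a c, scl a u)"
  by (simp add: ham_scale_def scl_def)

lemma pairing_zero_left [simp]: "pairing N 0 t = 0"
  by (simp add: pairing_def fun_apply)

text \<open>The torus terms may leave the cutoff at index zero, because elements of
  \<open>LP\<close> have no coefficient there.\<close>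

lemma ham_bracket_pair:
  assumes "c1 \<in> LP (2*m)" "c2 \<in> LP (2*m)"
  shows "ham_bracket m (c1, u1) (c2, u2) =
    (poisson m c1 c2 + (\<lambda>t. pairing (2*m) u1 t * c2 t - pairing (2*m) u2 t * c1 t), 0)"
proof -
  have "c1 (\<lambda>_. 0) = 0" "c2 (\<lambda>_. 0) = 0"
    using assms[THEN LP_at_zero] by (simp_all only: zero_fun_def)
  then show ?thesis
    unfolding ham_bracket_def poisson_def omega_def plus_fun_def zero_fun_def fun_diff_def prod.case
    by (intro arg_cong2[of _ _ _ _ Pair] ext) auto
qed

lemma snd_ham_bracket: "snd (ham_bracket m x y) = 0"
  by (auto simp: ham_bracket_def zero_fun_def split: prod.split)

lemma LP_torus_part:
  assumes "c1 \<in> LP N" "c2 \<in> LP N"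
  shows "(\<lambda>t. f t * c2 t - g t * c1 t) \<in> LP N"
  by (rule LP_I[of "{r. c1 r \<noteq> 0} \<union> {r. c2 r \<noteq> 0}"]) (use assms in \<open>auto simp: LP_def\<close>)

lemma ham_bracket_derived:
  assumes "x \<in> ham_carrier (2*m)" "y \<in> ham_carrier (2*m)"
  shows "ham_bracket m x y \<in> ham_derived_carrier (2*m)"
  using assms
  by (cases x; cases y)
    (simp add: ham_carrier_iff ham_derived_carrier_iff ham_bracket_pair LP_add poisson_LP LP_torus_part)

section \<open>Homomorphisms of a Lie algebra on a carrier set and its automorphism group\<close>

definition lie_closed :: "'a set \<Rightarrow> ('a \<Rightarrow> 'a \<Rightarrow> 'a) \<Rightarrow> ('k \<Rightarrow> 'a \<Rightarrow> 'a) \<Rightarrow> ('a \<Rightarrow> 'a \<Rightarrow> 'a) \<Rightarrow> bool" where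
  "lie_closed V add sc br \<longleftrightarrow> (\<forall>x\<in>V. \<forall>y\<in>V. add x y \<in> V) \<and> (\<forall>a. \<forall>x\<in>V. sc a x \<in> V) \<and>
     (\<forall>x\<in>V. \<forall>y\<in>V. br x y \<in> V)"

definition lie_hom :: "'a set \<Rightarrow> ('a \<Rightarrow> 'a \<Rightarrow> 'a) \<Rightarrow> ('k \<Rightarrow> 'a \<Rightarrow> 'a) \<Rightarrow> ('a \<Rightarrow> 'a \<Rightarrow> 'a) \<Rightarrow> ('a \<Rightarrow> 'a) \<Rightarrow> bool" where
  "lie_hom V add sc br f \<longleftrightarrow> f \<in> V \<rightarrow> V \<and> (\<forall>x\<in>V. \<forall>y\<in>V. f (add x y) = add (f x) (f y)) \<and>
     (\<forall>a. \<forall>x\<in>V. f (sc a x) = sc a (f x)) \<and> (\<forall>x\<in>V. \<forall>y\<in>V. f (br x y) = br (f x) (f y))"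

lemma lie_homD:
  assumes "lie_hom V add sc br f" "x \<in> V"
  shows "f x \<in> V" "f (sc a x) = sc a (f x)"
    "y \<in> V \<Longrightarrow> f (add x y) = add (f x) (f y)" "y \<in> V \<Longrightarrow> f (br x y) = br (f x) (f y)"
  using assms by (auto simp: lie_hom_def)

lemma lie_aut_group_carrier:
  "f \<in> carrier (lie_aut_group V add sc br) \<longleftrightarrow>
    f \<in> extensional V \<and> bij_betw f V V \<and> lie_hom V add sc br f"
  by (auto simp: lie_aut_group_def lie_hom_def Bij_def bij_betw_def)

lemma lie_hom_cong:
  assumes "lie_closed V add sc br" "\<And>x. x \<in> V \<Longrightarrow> f x = g x" "lie_hom V add sc br f"
  shows "lie_hom V add sc br g"
  using assms unfolding lie_hom_def lie_closed_def by (auto simp: Pi_iff)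

lemma lie_hom_inv_into:
  assumes V: "lie_closed V add sc br" and bij: "bij_betw f V V" and f: "lie_hom V add sc br f"
  shows "lie_hom V add sc br (inv_into V f)"
proof -
  have g: "inv_into V f x \<in> V" "f (inv_into V f x) = x" if "x \<in> V" for x
    using bij that by (auto simp: bij_betw_def f_inv_into_f intro: inv_into_into)
  have eq: "inv_into V f x = y" if "y \<in> V" "f y = x" for x y
    using bij that by (auto simp: bij_betw_def)
  show ?thesis
    unfolding lie_hom_def
    by (intro conjI ballI allI funcsetI eq)
      (use V g in \<open>auto simp: lie_closed_def lie_homD[OF f]\<close>)
qed

text \<open>A faithful action by Lie homomorphisms that reaches every automorphism is an isomorphism
  onto the automorphism group. Inverses in \<open>G\<close> make each \<open>\<phi> p\<close>
  bijective; the restriction to \<open>V\<close> is there because elements of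
  \<open>BijGroup V\<close> are extensional. Both algebras are instances.\<close>

lemma iso_lie_aut_group:
  fixes G :: "'p monoid"
  assumes V: "lie_closed V add sc br"
    and hom: "\<And>p. p \<in> carrier G \<Longrightarrow> lie_hom V add sc br (\<phi> p)"
    and mult: "\<And>p q x. p \<in> carrier G \<Longrightarrow> q \<in> carrier G \<Longrightarrow> x \<in> V \<Longrightarrow> \<phi> p (\<phi> q x) = \<phi> (p \<otimes>\<^bsub>G\<^esub> q) x"
    and one: "\<And>x. x \<in> V \<Longrightarrow> \<phi> \<one>\<^bsub>G\<^esub> x = x"
    and inverse: "\<And>p. p \<in> carrier G \<Longrightarrow> \<exists>q\<in>carrier G. p \<otimes>\<^bsub>G\<^esub> q = \<one>\<^bsub>G\<^esub> \<and> q \<otimes>\<^bsub>G\<^esub> p = \<one>\<^bsub>G\<^esub>"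
    and faithful: "\<And>p q. p \<in> carrier G \<Longrightarrow> q \<in> carrier G \<Longrightarrow> (\<And>x. x \<in> V \<Longrightarrow> \<phi> p x = \<phi> q x) \<Longrightarrow> p = q"
    and surj: "\<And>f. bij_betw f V V \<Longrightarrow> lie_hom V add sc br f \<Longrightarrow> \<exists>p\<in>carrier G. \<forall>x\<in>V. f x = \<phi> p x"
  shows "(\<lambda>p. restrict (\<phi> p) V) \<in> iso G (lie_aut_group V add sc br)"
proof -
  have closed: "\<phi> p x \<in> V" if "p \<in> carrier G" "x \<in> V" for p x
    using lie_homD(1)[OF hom that(2)] that by blast
  have bij: "bij_betw (\<phi> p) V V" if p: "p \<in> carrier G" for p
  proof -
    obtain q where q: "q \<in> carrier G" "p \<otimes>\<^bsub>G\<^esub> q = \<one>\<^bsub>G\<^esub>" "q \<otimes>\<^bsub>G\<^esub> p = \<one>\<^bsub>G\<^esub>"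
      using inverse[OF p] by blast
    show ?thesis
      by (rule bij_betw_byWitness[where f' = "\<phi> q"]) (use p q closed mult one in auto)
  qed
  have aut: "restrict (\<phi> p) V \<in> carrier (lie_aut_group V add sc br)" if p: "p \<in> carrier G" for p
    unfolding lie_aut_group_carrier
  proof (intro conjI)
    show "bij_betw (restrict (\<phi> p) V) V V"
      using bij[OF p] by (simp cong: bij_betw_cong)
    show "lie_hom V add sc br (restrict (\<phi> p) V)"
      by (rule lie_hom_cong[OF V _ hom[OF p]]) simp
  qed simp
  have Bij: "restrict (\<phi> p) V \<in> Bij V" if "p \<in> carrier G" for p
    using aut[OF that] by (simp add: lie_aut_group_def)
  have "restrict (\<phi> (p \<otimes>\<^bsub>G\<^esub> q)) V =
      restrict (\<phi> p) V \<otimes>\<^bsub>lie_aut_group V add sc br\<^esub> restrict (\<phi> q) V"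
    if "p \<in> carrier G" "q \<in> carrier G" for p q
    using that closed mult Bij
    by (auto simp: lie_aut_group_def BijGroup_def compose_def restrict_def fun_eq_iff)
  moreover have "inj_on (\<lambda>p. restrict (\<phi> p) V) (carrier G)"
    by (intro inj_onI faithful) (auto dest: fun_cong simp: restrict_def split: if_splits)
  moreover have "f \<in> (\<lambda>p. restrict (\<phi> p) V) ` carrier G"
    if f: "f \<in> carrier (lie_aut_group V add sc br)" for f
  proof -
    obtain p where p: "p \<in> carrier G" "\<forall>x\<in>V. f x = \<phi> p x"
      using f surj unfolding lie_aut_group_carrier by blast
    have "f = restrict (\<phi> p) V"
      using f p by (auto simp: lie_aut_group_carrier intro!: extensionalityI[of f V])
    then show ?thesis using p by blast
  qed
  ultimately show ?thesis
    using aut by (auto simp: iso_def hom_def bij_betw_def)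
qed

text \<open>Going back along \<open>f\<close> and on along \<open>g\<close>. Taking the identity for
  \<open>g\<close> turns it into symmetry of isomorphism.\<close>

lemma is_iso_common_source:
  assumes closed: "\<And>x y. x \<in> carrier G \<Longrightarrow> y \<in> carrier G \<Longrightarrow> x \<otimes>\<^bsub>G\<^esub> y \<in> carrier G"
    and f: "f \<in> iso G H" and g: "g \<in> iso G K"
  shows "H \<cong> K"
proof -
  let ?h = "inv_into (carrier G) f"
  have bf: "bij_betw f (carrier G) (carrier H)" and hf: "f \<in> hom G H"
    and bg: "bij_betw g (carrier G) (carrier K)" and hg: "g \<in> hom G K"
    using f g by (auto simp: iso_def)
  have h: "?h x \<in> carrier G" "f (?h x) = x" if "x \<in> carrier H" for x
    using bf that by (auto simp: bij_betw_def f_inv_into_f intro: inv_into_into)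
  have "?h (x \<otimes>\<^bsub>H\<^esub> y) = ?h x \<otimes>\<^bsub>G\<^esub> ?h y" if "x \<in> carrier H" "y \<in> carrier H" for x y
    using that h closed hf bf by (intro inv_into_f_eq) (auto simp: hom_mult bij_betw_def)
  then have "(\<lambda>x. g (?h x)) \<in> hom H K"
    using h hg by (auto simp: hom_def)
  moreover have "bij_betw (\<lambda>x. g (?h x)) (carrier H) (carrier K)"
    using bij_betw_trans[OF bij_betw_inv_into[OF bf] bg] by (simp add: o_def)
  ultimately show ?thesis by (auto simp: is_iso_def iso_def)
qed

lemma lie_closed_ham: "lie_closed (ham_carrier (2*m)) ham_add ham_scale (ham_bracket m)"
  unfolding lie_closed_def
proof (intro conjI ballI allI)
  fix x y :: "'a ham" assume xy: "x \<in> ham_carrier (2*m)" "y \<in> ham_carrier (2*m)"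
  show "ham_add x y \<in> ham_carrier (2*m)"
    using xy by (cases x; cases y) (simp add: ham_carrier_iff ham_add_pair LP_add plus_fun_apply)
  show "ham_bracket m x y \<in> ham_carrier (2*m)"
    by (rule ham_derived_subset[THEN subsetD, OF ham_bracket_derived[OF xy]])
next
  fix a and x :: "'a ham" assume "x \<in> ham_carrier (2*m)"
  then show "ham_scale a x \<in> ham_carrier (2*m)"
    by (cases x) (simp add: ham_carrier_iff ham_scale_pair LP_scl, simp add: scl_def)
qed

lemma lie_closed_ham_derived: "lie_closed (ham_derived_carrier (2*m)) ham_add ham_scale (ham_bracket m)"
  unfolding lie_closed_def
proof (intro conjI ballI allI)
  fix x y :: "'a ham" assume xy: "x \<in> ham_derived_carrier (2*m)" "y \<in> ham_derived_carrier (2*m)"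
  show "ham_add x y \<in> ham_derived_carrier (2*m)"
    using xy by (cases x; cases y) (simp add: ham_derived_carrier_iff ham_add_pair LP_add)
  show "ham_bracket m x y \<in> ham_derived_carrier (2*m)"
    using xy ham_derived_subset by (intro ham_bracket_derived) auto
next
  fix a and x :: "'a ham" assume "x \<in> ham_derived_carrier (2*m)"
  then show "ham_scale a x \<in> ham_derived_carrier (2*m)"
    by (cases x) (simp add: ham_derived_carrier_iff ham_scale_pair LP_scl, simp add: scl_def zero_fun_def)
qed

section \<open>The semidirect product acting on the full algebra\<close>

lemma actU_zero [simp]: "actU N Q 0 = 0"
  by (rule ext) (simp add: actU_def fun_apply)

lemma actU_add: "actU N Q (u + v) = actU N Q u + actU N Q v"
  by (rule ext) (simp add: actU_def fun_apply algebra_simps sum.distrib)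

lemma actU_scl: "actU N Q (scl a u) = scl a (actU N Q u)"
  by (rule ext) (simp add: actU_def scl_def sum_distrib_left algebra_simps)

lemma actU_mul: "actU N A (actU N B u) = actU N (mat_mul N A B) u"
proof
  fix i
  have "actU N A (actU N B u) i = (\<Sum>j<N. \<Sum>k<N. of_int (A i j) * of_int (B j k) * u k)"
    by (simp add: actU_def sum_distrib_left mult.assoc)
  also have "\<dots> = (\<Sum>k<N. \<Sum>j<N. of_int (A i j) * of_int (B j k) * u k)" by (rule sum.swap)
  also have "\<dots> = actU N (mat_mul N A B) u i"
    by (simp add: actU_def mat_mul_def sum_distrib_right)
  finally show "actU N A (actU N B u) i = actU N (mat_mul N A B) u i" .
qed

lemma actU_id:
  assumes "\<forall>i\<ge>N. u i = 0"
  shows "actU N (mat_id N) u = u"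
proof
  fix i
  have "actU N (mat_id N) u i = (\<Sum>j<N. if j = i then u i else 0)"
    unfolding actU_def by (intro sum.cong) (auto simp: mat_id_def)
  then show "actU N (mat_id N) u i = u i" using assms by auto
qed

lemma actU_support: "Q \<in> intmats N \<Longrightarrow> i \<ge> N \<Longrightarrow> actU N Q u i = 0"
  by (simp add: actU_def intmats_def)

lemma pairing_actU: "pairing N (actU N Q u) t = pairing N u (tv N Q t)"
proof -
  have "pairing N (actU N Q u) t = (\<Sum>i<N. \<Sum>j<N. of_int (Q i j) * u j * of_int (t i))"
    by (simp add: pairing_def actU_def sum_distrib_right)
  also have "\<dots> = (\<Sum>j<N. \<Sum>i<N. of_int (Q i j) * u j * of_int (t i))" by (rule sum.swap)
  also have "\<dots> = pairing N u (tv N Q t)"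
    by (simp add: pairing_def tv_def sum_distrib_left algebra_simps)
  finally show ?thesis .
qed

lemma lie_hom_act:
  fixes a :: "nat \<Rightarrow> 'k::field"
  assumes Q: "Q \<in> GSp_Z m" and a: "a \<in> torus (2*m)"
  shows "lie_hom (ham_carrier (2*m)) ham_add ham_scale (ham_bracket m) (act m (Q, a))"
  unfolding lie_hom_def
proof (intro conjI ballI allI funcsetI)
  fix x :: "'k ham" assume "x \<in> ham_carrier (2*m)"
  then obtain c u where x: "x = (c, u)" "c \<in> LP (2*m)" by (cases x) (auto simp: ham_carrier_iff)
  note lin = actL_linear[OF Q, of a]
  show "act m (Q, a) x \<in> ham_carrier (2*m)"
    using x Q by (simp add: act_pair ham_carrier_iff actL_LP actU_support GSp_Z_intmats)
  show "act m (Q, a) (ham_scale k x) = ham_scale k (act m (Q, a) x)" for k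
    using x by (simp add: act_pair ham_scale_pair lp_linear_scl[OF lin] actU_scl)
  fix y :: "'k ham" assume "y \<in> ham_carrier (2*m)"
  then obtain d v where y: "y = (d, v)" "d \<in> LP (2*m)" by (cases y) (auto simp: ham_carrier_iff)
  show "act m (Q, a) (ham_add x y) = ham_add (act m (Q, a) x) (act m (Q, a) y)"
    using x y by (simp add: act_pair ham_add_pair lp_linear_add[OF lin] actU_add)
  have "actL m Q a (\<lambda>t. pairing (2*m) u t * d t - pairing (2*m) v t * c t) =
      (\<lambda>t. pairing (2*m) (actU (2*m) Q u) t * actL m Q a d t - pairing (2*m) (actU (2*m) Q v) t * actL m Q a c t)"
    by (rule ext) (simp add: actL_def pairing_actU right_diff_distrib mult_ac[where 'a='k])
  then show "act m (Q, a) (ham_bracket m x y) = ham_bracket m (act m (Q, a) x) (act m (Q, a) y)"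
    using x y Q
    by (simp add: ham_bracket_pair act_pair actL_LP lp_linear_add[OF lin] poisson_LP LP_torus_part
        actL_poisson[OF Q a])
qed

lemma lie_hom_act_derived:
  assumes Q: "Q \<in> GSp_Z m" and a: "a \<in> torus (2*m)"
  shows "lie_hom (ham_derived_carrier (2*m)) ham_add ham_scale (ham_bracket m) (act m (Q, a))"
proof -
  have "act m (Q, a) x \<in> ham_derived_carrier (2*m)" if "x \<in> ham_derived_carrier (2*m)" for x
    using that Q by (cases x) (simp add: act_pair ham_derived_carrier_iff actL_LP)
  then show ?thesis
    using lie_hom_act[OF Q a] ham_derived_subset[of "2*m"] unfolding lie_hom_def by blast
qed

lemma act_mul:
  assumes "m \<ge> 1" "Q1 \<in> GSp_Z m" "Q2 \<in> GSp_Z m" "a2 \<in> torus (2*m)"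
  shows "act m (Q1, a1) (act m (Q2, a2) x) =
    act m (mat_mul (2*m) Q1 Q2, \<lambda>j. a1 j * torus_act (2*m) Q1 a2 j) x"
  using actL_mul[OF assms] by (simp add: act_def actU_mul)

lemma act_id: "x \<in> ham_carrier (2*m) \<Longrightarrow> act m (mat_id (2*m), \<lambda>_. 1) x = x"
  by (cases x) (simp add: act_pair ham_carrier_iff actL_id actU_id)

text \<open>Testing on the basis element at \<open>Q1^T t\<close> and reading off the coefficient at
  \<open>t\<close> gives a nonzero value on the left, hence \<open>Q2^T t\<close> is the same index.
  Once the matrices agree, so do the signs, and the characters coincide.\<close>

lemma actL_faithful:
  fixes a1 a2 :: "nat \<Rightarrow> 'k::field"
  assumes Q: "Q1 \<in> GSp_Z m" "Q2 \<in> GSp_Z m" and a: "a1 \<in> torus (2*m)" "a2 \<in> torus (2*m)"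
    and eq: "\<And>c. c \<in> LP (2*m) \<Longrightarrow> actL m Q1 a1 c = actL m Q2 a2 c"
  shows "Q1 = Q2" "a1 = a2"
proof -
  have tv_chr: "tv (2*m) Q1 t = tv (2*m) Q2 t \<and>
      of_int (gsign m Q1) * chr (2*m) a1 t = of_int (gsign m Q2) * chr (2*m) a2 t"
    if t: "t \<in> nzvecs (2*m)" for t
  proof -
    define c where "c = (hbasis (tv (2*m) Q1 t) :: _ \<Rightarrow> 'k)"
    have "c \<in> LP (2*m)" unfolding c_def by (rule LP_hbasis[OF tv_nonzero[OF Q(1) t]])
    from fun_cong[OF eq[OF this], of t]
    have "of_int (gsign m Q1) * chr (2*m) a1 t =
        of_int (gsign m Q2) * chr (2*m) a2 t * c (tv (2*m) Q2 t)"
      using t by (simp add: actL_def c_def)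
    moreover have "of_int (gsign m Q1) * chr (2*m) a1 t \<noteq> 0"
      using chr_nonzero[OF a(1)] by simp
    ultimately show ?thesis by (auto simp: c_def hbasis_def split: if_splits)
  qed
  show "Q1 = Q2"
  proof (rule intmats_eqI[of _ "2*m"])
    fix i assume i: "i < 2*m"
    then have "tv (2*m) Q1 (unit_vec i) = tv (2*m) Q2 (unit_vec i)"
      using tv_chr[of "unit_vec i"] by (simp add: unit_vec_zvecs unit_vec_nonzero)
    then show "Q1 i = Q2 i" using i by (simp add: tv_unit)
  qed (use Q in \<open>simp_all add: GSp_Z_intmats\<close>)
  then show "a1 = a2" using a tv_chr by (intro torus_eqI[of a1 "2*m"]) auto
qed

lemma ham_derived_surj:
  fixes f :: "'k::field_char_0 ham \<Rightarrow> 'k ham"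
  assumes m: "m \<ge> 1"
    and bij: "bij_betw f (ham_derived_carrier (2*m)) (ham_derived_carrier (2*m))"
    and hom: "lie_hom (ham_derived_carrier (2*m)) ham_add ham_scale (ham_bracket m) f"
  obtains Q a where "Q \<in> GSp_Z m" "a \<in> torus (2*m)"
    "\<And>x. x \<in> ham_derived_carrier (2*m) \<Longrightarrow> f x = act m (Q, a) x"
proof -
  let ?V = "ham_derived_carrier (2*m) :: 'k ham set" and ?L = "LP (2*m) :: ((nat \<Rightarrow> int) \<Rightarrow> 'k) set"
  define s where "s = (\<lambda>c. fst (f (c, 0)))"
  have fs: "f (c, 0) = (s c, 0)" and sL: "s c \<in> ?L" if "c \<in> ?L" for c
  proof -
    have "f (c, 0) \<in> ?V" using that by (intro lie_homD(1)[OF hom]) (simp add: ham_derived_carrier_iff)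
    then show "f (c, 0) = (s c, 0)" "s c \<in> ?L"
      by (cases "f (c, 0)"; simp add: s_def ham_derived_carrier_iff)+
  qed
  have scl0: "scl k (0 :: nat \<Rightarrow> 'k) = 0" for k by (simp add: scl_def zero_fun_def)
  have V: "(c, 0) \<in> ?V" if "c \<in> ?L" for c using that by (simp add: ham_derived_carrier_iff)
  have "lie_auto m s"
    unfolding lie_auto_def lp_linear_def
  proof (intro conjI ballI allI funcsetI)
    have "bij_betw (\<lambda>c. (c, 0)) ?L ?V"
      by (rule bij_betw_byWitness[where f' = fst]) (auto simp: ham_derived_carrier_iff)
    moreover have "bij_betw fst ?V ?L"
      by (rule bij_betw_byWitness[where f' = "\<lambda>c. (c, 0)"]) (auto simp: ham_derived_carrier_iff)
    ultimately have "bij_betw (fst \<circ> (f \<circ> (\<lambda>c. (c, 0)))) ?L ?L"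
      using bij by (blast intro: bij_betw_trans)
    then show "bij_betw s ?L ?L" by (simp add: s_def o_def)
    fix x assume x: "x \<in> ?L"
    show "s x \<in> ?L" by (rule sL[OF x])
    show "s (scl k x) = scl k (s x)" for k
      using lie_homD(2)[OF hom V[OF x], of k] x by (simp add: ham_scale_pair fs scl0 LP_scl)
    fix y assume y: "y \<in> ?L"
    show "s (x + y) = s x + s y"
      using lie_homD(3)[OF hom V[OF x] V[OF y]] x y by (simp add: ham_add_pair fs LP_add)
    have "ham_bracket m (c, 0) (d, 0) = (poisson m c d, 0)" if "c \<in> ?L" "d \<in> ?L" for c d
      using that by (simp add: ham_bracket_pair) (simp add: zero_fun_def[symmetric])
    then show "s (poisson m x y) = poisson m (s x) (s y)"
      using lie_homD(4)[OF hom V[OF x] V[OF y]] x y by (simp add: fs sL poisson_LP)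
  qed
  then obtain Q a where Qa: "Q \<in> GSp_Z m" "a \<in> torus (2*m)" "\<And>c. c \<in> ?L \<Longrightarrow> s c = actL m Q a c"
    using lie_auto_classification[OF m] by metis
  have "f x = act m (Q, a) x" if "x \<in> ?V" for x
    using that Qa(3) fs by (cases x) (simp add: ham_derived_carrier_iff act_pair)
  then show ?thesis using that Qa by blast
qed

text \<open>Each \<open>h_r\<close> is itself a bracket \<open>[D(u, 0), h_r]\<close> with
  \<open>(u, r) = 1\<close>, and brackets have no torus part. No bijectivity enters, so the lemma
  serves an automorphism and its inverse alike.\<close>

lemma ham_hom_derived:
  fixes f :: "'k::field_char_0 ham \<Rightarrow> 'k ham"
  assumes hom: "lie_hom (ham_carrier (2*m)) ham_add ham_scale (ham_bracket m) f"
    and x: "x \<in> ham_derived_carrier (2*m)"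
  shows "f x \<in> ham_derived_carrier (2*m)"
proof -
  have derI: "f y \<in> ham_derived_carrier (2*m)" if "y \<in> ham_carrier (2*m)" "snd (f y) = 0" for y
    using lie_homD(1)[OF hom that(1)] that(2) by (cases "f y") (simp add: ham_carrier_iff ham_derived_carrier_iff)
  have in_V: "(c, 0) \<in> ham_carrier (2*m)" if "c \<in> LP (2*m)" for c :: "_ \<Rightarrow> 'k"
    using that by (simp add: ham_carrier_iff fun_apply)
  have scl0: "scl k (0 :: nat \<Rightarrow> 'k) = 0" for k by (simp add: scl_def zero_fun_def)
  have basis: "snd (f (hbasis r, 0)) = 0" if r: "r \<in> nzvecs (2*m)" for r
  proof -
    obtain i where i: "i < 2*m" "r i \<noteq> 0" using r by (rule zvecs_nonzero_coord)
    \<comment> \<open>Concentrated on one coordinate where \<open>r\<close> is nonzero;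
      characteristic zero makes that entry invertible in the field.\<close>
    define u where "u j = (if j = i then inverse (of_int (r i)) else (0::'k))" for j
    have "pairing (2*m) u r = (\<Sum>j<2*m. if j = i then 1 else 0)"
      unfolding pairing_def using i by (intro sum.cong) (auto simp: u_def)
    then have u: "pairing (2*m) u r = 1" using i by simp
    have "(0, u) \<in> ham_carrier (2*m)" using i by (auto simp: ham_carrier_iff u_def)
    moreover have "ham_bracket m (0, u) (hbasis r, 0) = (hbasis r, 0)"
    proof -
      have "poisson m 0 (hbasis r) + (\<lambda>t. pairing (2*m) u t * hbasis r t - pairing (2*m) 0 t * (0 :: _ \<Rightarrow> 'k) t) =
          hbasis r"
        by (rule ext) (auto simp: plus_fun_apply poisson_def zero_fun_apply hbasis_def u)
      then show ?thesis by (simp only: ham_bracket_pair[OF LP_zero LP_hbasis[OF r]])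
    qed
    ultimately have "f (hbasis r, 0) = ham_bracket m (f (0, u)) (f (hbasis r, 0))"
      using lie_homD(4)[OF hom, of "(0, u)" "(hbasis r, 0)"] in_V[OF LP_hbasis[OF r]] by simp
    then show ?thesis using snd_ham_bracket by metis
  qed
  have snd_scale: "snd (ham_scale k z) = scl k (snd z)" for k and z :: "'k ham"
    by (simp add: ham_scale_def scl_def)
  have snd_add: "snd (ham_add z w) = snd z + snd w" for z w :: "'k ham"
    by (simp add: ham_add_def plus_fun_def)
  have "snd (f (c, 0)) = 0" if "c \<in> LP (2*m)" for c
    using that
  proof (induction rule: LP_induct)
    case zero
    have "f (ham_scale 0 (0, 0)) = ham_scale 0 (f (0, 0))"
      by (rule lie_homD(2)[OF hom in_V]) simp
    then have eq: "f (0, 0) = ham_scale 0 (f (0, 0))" by (simp add: ham_scale_pair scl_zero)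
    show ?case by (subst eq) (simp add: snd_scale scl_zero)
  next
    case (add c k r)
    have h: "(hbasis r :: _ \<Rightarrow> 'k, 0 :: _ \<Rightarrow> 'k) \<in> ham_carrier (2*m)" by (rule in_V[OF LP_hbasis[OF add(2)]])
    have "ham_scale k (hbasis r :: _ \<Rightarrow> 'k, 0 :: _ \<Rightarrow> 'k) \<in> ham_carrier (2*m)"
      unfolding ham_scale_pair scl0 by (rule in_V[OF LP_scl[OF LP_hbasis[OF add(2)]]])
    moreover have "(c + scl k (hbasis r), 0) = ham_add (c, 0) (ham_scale k (hbasis r, 0))"
      by (simp add: ham_add_pair ham_scale_pair scl0)
    ultimately have "f (c + scl k (hbasis r), 0) = ham_add (f (c, 0)) (ham_scale k (f (hbasis r, 0)))"
      using lie_homD(3)[OF hom in_V[OF add(1)]] lie_homD(2)[OF hom h] by simp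
    then show ?case using add basis[OF add(2)] by (simp add: snd_add snd_scale scl0)
  qed
  then show ?thesis
    using x by (cases x) (auto simp: ham_derived_carrier_iff intro!: derI in_V)
qed

text \<open>Triviality of the centralizer of \<open>H'\<close>, tested on basis elements: the
  coefficient at \<open>r + unit_vec j\<close> of the bracket with \<open>h_(e_j)\<close> shows
  \<open>c r\<close>, and the one at \<open>e_i\<close> of the bracket with \<open>h_(e_i)\<close>
  shows \<open>u i\<close>.\<close>

lemma ham_derived_separates:
  fixes x y :: "'k::field_char_0 ham"
  assumes x: "x \<in> ham_carrier (2*m)" and y: "y \<in> ham_carrier (2*m)"
    and eq: "\<And>w. w \<in> ham_derived_carrier (2*m) \<Longrightarrow> ham_bracket m x w = ham_bracket m y w"
  shows "x = y"
proof -
  obtain c u d v where xy: "x = (c, u)" "y = (d, v)" by (cases x; cases y)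
  have c: "c \<in> LP (2*m)" "\<forall>i\<ge>2*m. u i = 0" and d: "d \<in> LP (2*m)" "\<forall>i\<ge>2*m. v i = 0"
    using x y by (auto simp: xy ham_carrier_iff)
  have fst_br: "fst (ham_bracket m (c, u) (hbasis s, 0)) t =
      c (t - s) * of_int (omega m (t - s) s) + pairing (2*m) u t * hbasis s t"
    if "c \<in> LP (2*m)" "s \<in> nzvecs (2*m)" "t \<noteq> 0" for c :: "_ \<Rightarrow> 'k" and u s t
    using that
    by (simp add: ham_bracket_pair LP_hbasis plus_fun_apply poisson_hbasis_right LP_finite)
  have main: "c (t - s) * of_int (omega m (t - s) s) + pairing (2*m) u t * hbasis s t =
      d (t - s) * of_int (omega m (t - s) s) + pairing (2*m) v t * hbasis s t"
    if "s \<in> nzvecs (2*m)" "t \<noteq> 0" for s t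
    using eq[of "(hbasis s, 0)"] that c(1) d(1) fst_br[of c s t u] fst_br[of d s t v]
    by (simp add: xy ham_derived_carrier_iff LP_hbasis)
  have "c r = d r" for r
  proof (cases "r \<in> nzvecs (2*m)")
    case True
    then obtain j where j: "j < 2*m" "omega m r (unit_vec j) \<noteq> 0" by (rule omega_nondegenerate)
    have "r + unit_vec j \<noteq> 0" using j(2) by (auto simp: add_eq_0_iff omega_minus_right)
    then show ?thesis
      using main[of "unit_vec j" "r + unit_vec j"] j True
      by (simp add: unit_vec_zvecs unit_vec_nonzero hbasis_def)
  next
    case False
    then show ?thesis using LP_supp[OF c(1)] LP_supp[OF d(1)] by metis
  qed
  moreover have "u i = v i" for i
  proof (cases "i < 2*m")
    case True
    have p: "pairing (2*m) w (unit_vec i) = w i" for w :: "nat \<Rightarrow> 'k"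
    proof -
      have "pairing (2*m) w (unit_vec i) = (\<Sum>j<2*m. if j = i then w i else 0)"
        unfolding pairing_def by (intro sum.cong) (auto simp: unit_vec_def)
      then show ?thesis using True by simp
    qed
    show ?thesis
      using main[of "unit_vec i" "unit_vec i"] True
      by (simp add: unit_vec_zvecs unit_vec_nonzero p)
  qed (use c d in simp)
  ultimately show ?thesis by (simp add: xy fun_eq_iff)
qed

text \<open>On \<open>H'\<close> the map is already some \<open>act m (Q, a)\<close>. For general
  \<open>x\<close> and \<open>w\<close> in \<open>H'\<close>, both \<open>[f x, w]\<close> and
  \<open>[act x, w]\<close> are images of \<open>[x, g w]\<close>, which lies in \<open>H'\<close>,
  where the two maps agree.\<close>

lemma ham_surj:
  fixes f :: "'k::field_char_0 ham \<Rightarrow> 'k ham"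
  assumes m: "m \<ge> 1"
    and bij: "bij_betw f (ham_carrier (2*m)) (ham_carrier (2*m))"
    and hom: "lie_hom (ham_carrier (2*m)) ham_add ham_scale (ham_bracket m) f"
  obtains Q a where "Q \<in> GSp_Z m" "a \<in> torus (2*m)"
    "\<And>x. x \<in> ham_carrier (2*m) \<Longrightarrow> f x = act m (Q, a) x"
proof -
  let ?H = "ham_carrier (2*m) :: 'k ham set" and ?H' = "ham_derived_carrier (2*m) :: 'k ham set"
  note sub = ham_derived_subset[of "2*m", THEN subsetD]
  define g where "g = inv_into ?H f"
  have homg: "lie_hom ?H ham_add ham_scale (ham_bracket m) g"
    unfolding g_def by (rule lie_hom_inv_into[OF lie_closed_ham bij hom])
  have gf: "g (f x) = x" "f (g x) = x" if "x \<in> ?H" for x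
    using bij that by (auto simp: g_def bij_betw_def f_inv_into_f)
  have bij': "bij_betw f ?H' ?H'"
    by (rule bij_betw_byWitness[where f' = g])
      (use gf(1)[OF sub] gf(2)[OF sub] ham_hom_derived[OF hom] ham_hom_derived[OF homg]
        in \<open>simp_all add: image_subset_iff\<close>)
  have hom': "lie_hom ?H' ham_add ham_scale (ham_bracket m) f"
    using hom sub ham_hom_derived[OF hom] unfolding lie_hom_def by blast
  obtain Q a where Qa: "Q \<in> GSp_Z m" "a \<in> torus (2*m)" "\<And>x. x \<in> ?H' \<Longrightarrow> f x = act m (Q, a) x"
    using ham_derived_surj[OF m bij' hom'] by metis
  note homa = lie_hom_act[OF Qa(1,2)]
  have "f x = act m (Q, a) x" if x: "x \<in> ?H" for x
  proof (rule ham_derived_separates[of _ m])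
    show "f x \<in> ?H" "act m (Q, a) x \<in> ?H" using x lie_homD(1)[OF hom] lie_homD(1)[OF homa] by auto
    fix w assume w: "w \<in> ?H'"
    have gw: "g w \<in> ?H'" by (rule ham_hom_derived[OF homg w])
    have w_eq: "w = f (g w)" "w = act m (Q, a) (g w)" using gf(2)[OF sub[OF w]] Qa(3)[OF gw] by auto
    have "ham_bracket m (f x) w = f (ham_bracket m x (g w))"
      using lie_homD(4)[OF hom x sub[OF gw]] w_eq(1) by simp
    also have "\<dots> = act m (Q, a) (ham_bracket m x (g w))"
      by (intro Qa(3) ham_bracket_derived x sub[OF gw])
    also have "\<dots> = ham_bracket m (act m (Q, a) x) w"
      using lie_homD(4)[OF homa x sub[OF gw]] w_eq(2) by simp
    finally show "ham_bracket m (f x) w = ham_bracket m (act m (Q, a) x) w" .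
  qed
  then show ?thesis using that Qa by blast
qed

section \<open>The semidirect product and the two isomorphisms\<close>

lemma GSp_ltimes_torus_simps:
  "carrier (GSp_ltimes_torus m TYPE('k::field)) = GSp_Z m \<times> torus (2*m)"
  "(Q1, a1) \<otimes>\<^bsub>GSp_ltimes_torus m TYPE('k)\<^esub> (Q2, a2) =
    (mat_mul (2*m) Q1 Q2, \<lambda>j. a1 j * torus_act (2*m) Q1 a2 j)"
  "\<one>\<^bsub>GSp_ltimes_torus m TYPE('k)\<^esub> = (mat_id (2*m), \<lambda>_. 1)"
  by (simp_all add: GSp_ltimes_torus_def)

lemma GSp_ltimes_torus_closed:
  assumes "p \<in> carrier (GSp_ltimes_torus m TYPE('k::field))" "q \<in> carrier (GSp_ltimes_torus m TYPE('k))"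
  shows "p \<otimes>\<^bsub>GSp_ltimes_torus m TYPE('k)\<^esub> q \<in> carrier (GSp_ltimes_torus m TYPE('k))"
  using assms
  by (cases p; cases q) (simp add: GSp_ltimes_torus_simps GSp_Z_mul torus_mult torus_act_torus)

lemma GSp_ltimes_torus_inverse:
  assumes "p \<in> carrier (GSp_ltimes_torus m TYPE('k::field))"
  shows "\<exists>q\<in>carrier (GSp_ltimes_torus m TYPE('k)).
    p \<otimes>\<^bsub>GSp_ltimes_torus m TYPE('k)\<^esub> q = \<one>\<^bsub>GSp_ltimes_torus m TYPE('k)\<^esub> \<and>
    q \<otimes>\<^bsub>GSp_ltimes_torus m TYPE('k)\<^esub> p = \<one>\<^bsub>GSp_ltimes_torus m TYPE('k)\<^esub>"
proof -
  obtain Q a where p: "p = (Q, a)" "Q \<in> GSp_Z m" "a \<in> torus (2*m)"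
    using assms by (cases p) (auto simp: GSp_ltimes_torus_simps)
  obtain Q' where Q': "Q' \<in> GSp_Z m" "mat_mul (2*m) Q Q' = mat_id (2*m)" "mat_mul (2*m) Q' Q = mat_id (2*m)"
    using p(2) by (rule GSp_Z_obtain_inverse)
  \<comment> \<open>The usual inverse in a semidirect product: the inverse torus element, moved by
    the inverse matrix.\<close>
  define a' where "a' = torus_act (2*m) Q' (\<lambda>i. inverse (a i))"
  have inv_a: "(\<lambda>i. inverse (a i)) \<in> torus (2*m)" by (rule torus_inverse[OF p(3)])
  have a': "a' \<in> torus (2*m)" unfolding a'_def by (rule torus_act_torus[OF inv_a])
  have one: "(\<lambda>_. 1 :: 'k) \<in> torus (2*m)" by (simp add: torus_def)
  have chr_inv: "chr (2*m) a t * chr (2*m) (\<lambda>i. inverse (a i)) t = 1" for t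
  proof -
    have "chr (2*m) (\<lambda>i. a i * inverse (a i)) t = 1"
      unfolding chr_def by (rule prod.neutral) (use p(3) in \<open>auto simp: torus_def\<close>)
    then show ?thesis by (simp add: chr_mult)
  qed
  have "(\<lambda>j. a j * torus_act (2*m) Q a' j) = (\<lambda>_. 1)"
  proof (rule torus_eqI[of _ "2*m"])
    fix t assume "t \<in> nzvecs (2*m)"
    then have "tv (2*m) Q' (tv (2*m) Q t) = t" by (intro tv_inverse Q') auto
    then show "chr (2*m) (\<lambda>j. a j * torus_act (2*m) Q a' j) t = chr (2*m) (\<lambda>_. 1) t"
      by (simp add: chr_mult chr_torus_act a' chr_inv) (simp add: a'_def chr_torus_act inv_a chr_inv)
  qed (use p a' one in \<open>auto intro: torus_mult torus_act_torus\<close>)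
  moreover have "(\<lambda>j. a' j * torus_act (2*m) Q' a j) = (\<lambda>_. 1)"
  proof (rule torus_eqI[of _ "2*m"])
    fix t
    show "chr (2*m) (\<lambda>j. a' j * torus_act (2*m) Q' a j) t = chr (2*m) (\<lambda>_. 1) t"
      using chr_inv[of "tv (2*m) Q' t"]
      by (simp add: chr_mult chr_torus_act p a'_def inv_a mult.commute[where 'a='k])
  qed (use p a' one in \<open>auto intro: torus_mult torus_act_torus\<close>)
  ultimately show ?thesis
    using p Q' a' by (intro bexI[of _ "(Q', a')"]) (auto simp: GSp_ltimes_torus_simps)
qed

lemma iso_Aut_H':
  assumes m: "m \<ge> 1"
  shows "(\<lambda>p. restrict (act m p) (ham_derived_carrier (2*m))) \<in>
    iso (GSp_ltimes_torus m TYPE('k::field_char_0)) (Aut_H' m TYPE('k))"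
  unfolding Aut_H'_def
proof (rule iso_lie_aut_group[OF lie_closed_ham_derived])
  let ?G = "GSp_ltimes_torus m TYPE('k)" and ?V = "ham_derived_carrier (2*m) :: 'k ham set"
  fix p q :: "(nat \<Rightarrow> nat \<Rightarrow> int) \<times> (nat \<Rightarrow> 'k)"
  assume p: "p \<in> carrier ?G"
  show "lie_hom ?V ham_add ham_scale (ham_bracket m) (act m p)"
    using p by (cases p) (simp add: GSp_ltimes_torus_simps lie_hom_act_derived)
  show "\<exists>q\<in>carrier ?G. p \<otimes>\<^bsub>?G\<^esub> q = \<one>\<^bsub>?G\<^esub> \<and> q \<otimes>\<^bsub>?G\<^esub> p = \<one>\<^bsub>?G\<^esub>"
    by (rule GSp_ltimes_torus_inverse[OF p])
  assume q: "q \<in> carrier ?G"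
  show "act m p (act m q x) = act m (p \<otimes>\<^bsub>?G\<^esub> q) x" for x
    using p q m by (cases p; cases q) (simp add: GSp_ltimes_torus_simps act_mul)
  assume eq: "\<And>x. x \<in> ?V \<Longrightarrow> act m p x = act m q x"
  have "actL m (fst p) (snd p) c = actL m (fst q) (snd q) c" if "c \<in> LP (2*m)" for c
    using eq[of "(c, 0)"] that by (simp add: ham_derived_carrier_iff act_def)
  then show "p = q"
    using p q actL_faithful[of "fst p" m "fst q" "snd p" "snd q"]
    by (cases p; cases q) (auto simp: GSp_ltimes_torus_simps)
next
  show "act m \<one>\<^bsub>GSp_ltimes_torus m TYPE('k)\<^esub> x = x" if "x \<in> ham_derived_carrier (2*m)" for x
    using ham_derived_subset[THEN subsetD, OF that] by (simp add: GSp_ltimes_torus_simps act_id)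
next
  fix f :: "'k ham \<Rightarrow> 'k ham"
  assume "bij_betw f (ham_derived_carrier (2*m)) (ham_derived_carrier (2*m))"
    "lie_hom (ham_derived_carrier (2*m)) ham_add ham_scale (ham_bracket m) f"
  then obtain Q a where "Q \<in> GSp_Z m" "a \<in> torus (2*m)"
    "\<And>x. x \<in> ham_derived_carrier (2*m) \<Longrightarrow> f x = act m (Q, a) x"
    using ham_derived_surj[OF m] by metis
  then show "\<exists>p\<in>carrier (GSp_ltimes_torus m TYPE('k)). \<forall>x\<in>ham_derived_carrier (2*m). f x = act m p x"
    by (intro bexI[of _ "(Q, a)"]) (auto simp: GSp_ltimes_torus_simps)
qed

lemma iso_Aut_H:
  assumes m: "m \<ge> 1"
  shows "(\<lambda>p. restrict (act m p) (ham_carrier (2*m))) \<in>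
    iso (GSp_ltimes_torus m TYPE('k::field_char_0)) (Aut_H m TYPE('k))"
  unfolding Aut_H_def
proof (rule iso_lie_aut_group[OF lie_closed_ham])
  let ?G = "GSp_ltimes_torus m TYPE('k)" and ?V = "ham_carrier (2*m) :: 'k ham set"
  fix p q :: "(nat \<Rightarrow> nat \<Rightarrow> int) \<times> (nat \<Rightarrow> 'k)"
  assume p: "p \<in> carrier ?G"
  show "lie_hom ?V ham_add ham_scale (ham_bracket m) (act m p)"
    using p by (cases p) (simp add: GSp_ltimes_torus_simps lie_hom_act)
  show "\<exists>q\<in>carrier ?G. p \<otimes>\<^bsub>?G\<^esub> q = \<one>\<^bsub>?G\<^esub> \<and> q \<otimes>\<^bsub>?G\<^esub> p = \<one>\<^bsub>?G\<^esub>"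
    by (rule GSp_ltimes_torus_inverse[OF p])
  assume q: "q \<in> carrier ?G"
  show "act m p (act m q x) = act m (p \<otimes>\<^bsub>?G\<^esub> q) x" for x
    using p q m by (cases p; cases q) (simp add: GSp_ltimes_torus_simps act_mul)
  assume eq: "\<And>x. x \<in> ?V \<Longrightarrow> act m p x = act m q x"
  have "actL m (fst p) (snd p) c = actL m (fst q) (snd q) c" if "c \<in> LP (2*m)" for c
    using eq[of "(c, 0)"] that by (simp add: ham_carrier_iff act_def fun_apply)
  then show "p = q"
    using p q actL_faithful[of "fst p" m "fst q" "snd p" "snd q"]
    by (cases p; cases q) (auto simp: GSp_ltimes_torus_simps)
next
  show "act m \<one>\<^bsub>GSp_ltimes_torus m TYPE('k)\<^esub> x = x" if "x \<in> ham_carrier (2*m)" for x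
    using that by (simp add: GSp_ltimes_torus_simps act_id)
next
  fix f :: "'k ham \<Rightarrow> 'k ham"
  assume "bij_betw f (ham_carrier (2*m)) (ham_carrier (2*m))"
    "lie_hom (ham_carrier (2*m)) ham_add ham_scale (ham_bracket m) f"
  then obtain Q a where "Q \<in> GSp_Z m" "a \<in> torus (2*m)"
    "\<And>x. x \<in> ham_carrier (2*m) \<Longrightarrow> f x = act m (Q, a) x"
    using ham_surj[OF m] by metis
  then show "\<exists>p\<in>carrier (GSp_ltimes_torus m TYPE('k)). \<forall>x\<in>ham_carrier (2*m). f x = act m p x"
    by (intro bexI[of _ "(Q, a)"]) (auto simp: GSp_ltimes_torus_simps)
qed

theorem theorem3p6:
  fixes m :: nat
  assumes "alg_closed TYPE('k::field_char_0)"
    and "m \<ge> 1"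
  shows "Aut_H m TYPE('k) \<cong> Aut_H' m TYPE('k) \<and>
         Aut_H' m TYPE('k) \<cong> GSp_ltimes_torus m TYPE('k)"
proof
  show "Aut_H m TYPE('k) \<cong> Aut_H' m TYPE('k)"
    by (rule is_iso_common_source[OF GSp_ltimes_torus_closed iso_Aut_H[OF assms(2)] iso_Aut_H'[OF assms(2)]])
  show "Aut_H' m TYPE('k) \<cong> GSp_ltimes_torus m TYPE('k)"
    by (rule is_iso_common_source[OF GSp_ltimes_torus_closed iso_Aut_H'[OF assms(2)] iso_set_refl])
qed

end
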